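(* Let $X$ and $Y$ be Banach spaces (over the same field $\mathbb{K}\in\{\mathbb{R},\mathbb{C}\}$). Then: (a) $\mathrm{INA}_w(X\widehat{\otimes}_\pi Y)=\mathrm{INA}_\pi(X\widehat{\otimes}_\pi Y)$. (b) $\mathrm{INA}_{w^*}(X^*\widehat{\otimes}_\pi Y^* )=\mathrm{INA}_w(X^*\widehat{\otimes}_\pi Y^* )=\mathrm{INA}_\pi(X^*\widehat{\otimes}_\pi Y^* )$.
   Context: For a Banach space $X$, $B_X$ denotes the closed unit ball. $X\widehat{\otimes}_\pi Y$ is the completed projective tensor product with projective norm $\|\cdot\|_\pi$. Let $\tau$ be a Hausdorff topology on $B_X\times B_Y$. $\mathrm{INA}_\tau(X\widehat{\otimes}_\pi Y)$ is the set of $u\in X\widehat{\otimes}_\pi Y$ for which there is a finite positive measure $\mu$ on the Borel $\sigma$-algebra of $(B_X\times B_Y,\tau)$ such that the map $\varphi:B_X\times B_Y\to X\widehat{\otimes}_\pi Y$, $\varphi(x,y)=x\otimes y$, is $\mu$-Bochner integrable (i.e. it is the $\mu$-a.e. norm limit of a sequence of simple functions measurable for this $\sigma$-algebra, and $\int\|\varphi\|_\pi\,d\mu<\infty$), $u=\int_{B_X\times B_Y}\varphi\,d\mu$, and $\|\mu\|=\|u\|_\pi$, where $\|\mu\|=\mu(B_X\times B_Y)$. - $\mathrm{INA}_\pi(X\widehat{\otimes}_\pi Y)$ is the class obtained when $\tau$ is the product of the norm topologies of $B_X$ and $B_Y$. - $\mathrm{INA}_w(X\widehat{\otimes}_\pi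 Y)$ is the class obtained when $\tau$ is the product of the relative weak topologies of $B_X$ and $B_Y$. - $\mathrm{INA}_{w^*}(X^*\widehat{\otimes}_\pi Y^* )$ is the class (for the dual spaces $X^*,Y^*$) obtained when $\tau$ is the product of the relative weak-star topologies $\sigma(X^*,X)$ on $B_{X^*}$ and $\sigma(Y^*,Y)$ on $B_{Y^*}$. *)

theory Defs
  imports "HOL-Analysis.Analysis"
begin

section \<open>The scalar field\<close>

text \<open>
  The scalar fields are \<open>\<real>\<close> and \<open>\<complex>\<close>, up to an isometric isomorphism of fields.
\<close>

class real_or_complex = real_normed_field +
  assumes real_or_complex:
    "(\<exists>h :: 'a \<Rightarrow> real. bij h \<and> (\<forall>x y. h (x + y) = h x + h y) \<and> (\<forall>x y. h (x * y) = h x * h y) \<and>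
        (\<forall>r x. h (scaleR r x) = scaleR r (h x)) \<and> (\<forall>x. norm (h x) = norm x)) \<or>
     (\<exists>h :: 'a \<Rightarrow> complex. bij h \<and> (\<forall>x y. h (x + y) = h x + h y) \<and> (\<forall>x y. h (x * y) = h x * h y) \<and>
        (\<forall>r x. h (scaleR r x) = scaleR r (h x)) \<and> (\<forall>x. norm (h x) = norm x))"

instance real :: real_or_complex
  by standard (rule disjI1, rule exI[of _ id], simp)

instance complex :: real_or_complex
  by standard (rule disjI2, rule exI[of _ id], simp)


section \<open>Normed spaces over the scalar field\<close>

text \<open>
  A Banach space over \<open>'k\<close> is a type of class \<open>banach\<close> (its underlying real Banach space) with a
  scalar multiplication by \<open>'k\<close> that extends the real one and is compatible with the norm.
  The dual space is a subset of a type; therefore the notions below are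
  formulated for a \<open>'k\<close>-subspace \<open>S\<close> of such a type, the whole space being \<open>UNIV\<close>.
\<close>

locale normed_space_over = vector_space scale
  for scale :: "'k::real_or_complex \<Rightarrow> 'a::real_normed_vector \<Rightarrow> 'a" +
  assumes scale_of_real: "scale (of_real r) x = r *\<^sub>R x"
    and norm_scale: "norm (scale c x) = norm c * norm x"

definition bounded_functionals ::
    "('k::real_or_complex \<Rightarrow> 'a::real_normed_vector \<Rightarrow> 'a) \<Rightarrow> 'a set \<Rightarrow> ('a \<Rightarrow> 'k) set" where
  "bounded_functionals s S = {f. (\<forall>x\<in>S. \<forall>y\<in>S. f (x + y) = f x + f y) \<and>
     (\<forall>c. \<forall>x\<in>S. f (s c x) = c * f x) \<and> (\<exists>C. \<forall>x\<in>S. norm (f x) \<le> C * norm x)}"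

text \<open>
  The dual consists of the \<open>'k\<close>-linear maps among all bounded real-linear maps; the norm of the
  type \<open>'a \<Rightarrow>\<^sub>L 'k\<close> is the operator norm.
\<close>

definition dual_space ::
    "('k::real_or_complex \<Rightarrow> 'a::real_normed_vector \<Rightarrow> 'a) \<Rightarrow> ('a \<Rightarrow>\<^sub>L 'k) set" where
  "dual_space s = {f. blinfun_apply f \<in> bounded_functionals s UNIV}"

definition dual_scale ::
    "'k::real_or_complex \<Rightarrow> ('a::real_normed_vector \<Rightarrow>\<^sub>L 'k) \<Rightarrow> ('a \<Rightarrow>\<^sub>L 'k)" where
  "dual_scale c f = blinfun_mult_right c o\<^sub>L f"


section \<open>Norm, weak and weak-star topologies\<close>

definition initial_topology :: "'a set \<Rightarrow> ('a \<Rightarrow> 'k::topological_space) set \<Rightarrow> 'a topology" where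
  "initial_topology S F = topology_generated_by {S \<inter> f -` U | f U. f \<in> F \<and> open U}"

definition norm_topology :: "'a::real_normed_vector set \<Rightarrow> 'a topology" where
  "norm_topology S = subtopology euclidean S"

definition weak_topology ::
    "('k::real_or_complex \<Rightarrow> 'a::real_normed_vector \<Rightarrow> 'a) \<Rightarrow> 'a set \<Rightarrow> 'a topology" where
  "weak_topology s S = initial_topology S (bounded_functionals s S)"

definition weak_star_topology ::
    "('k::real_or_complex \<Rightarrow> 'a::real_normed_vector \<Rightarrow> 'a) \<Rightarrow> ('a \<Rightarrow>\<^sub>L 'k) topology" where
  "weak_star_topology s = initial_topology (dual_space s) (range (\<lambda>x f. blinfun_apply f x))"

text \<open>The product of two topologies, restricted to the closed unit balls of the two spaces.\<close>

definition ball_product ::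
    "'a::real_normed_vector topology \<Rightarrow> 'b::real_normed_vector topology \<Rightarrow> ('a \<times> 'b) topology" where
  "ball_product T1 T2 =
     prod_topology (subtopology T1 (cball 0 1)) (subtopology T2 (cball 0 1))"


section \<open>The completed projective tensor product\<close>

definition bilinear_over ::
    "('k::real_or_complex \<Rightarrow> 'a::real_normed_vector \<Rightarrow> 'a) \<Rightarrow> 'a set \<Rightarrow>
     ('k \<Rightarrow> 'b::real_normed_vector \<Rightarrow> 'b) \<Rightarrow> 'b set \<Rightarrow>
     ('k \<Rightarrow> 'z::real_vector \<Rightarrow> 'z) \<Rightarrow> ('a \<Rightarrow> 'b \<Rightarrow> 'z) \<Rightarrow> bool" where
  "bilinear_over sX S sY T sZ b \<longleftrightarrow>
     (\<forall>x\<in>S. \<forall>x'\<in>S. \<forall>y\<in>T. b (x + x') y = b x y + b x' y) \<and>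
     (\<forall>x\<in>S. \<forall>y\<in>T. \<forall>y'\<in>T. b x (y + y') = b x y + b x y') \<and>
     (\<forall>c. \<forall>x\<in>S. \<forall>y\<in>T. b (sX c x) y = sZ c (b x y)) \<and>
     (\<forall>c. \<forall>x\<in>S. \<forall>y\<in>T. b x (sY c y) = sZ c (b x y))"

definition tensor_sum :: "('a \<Rightarrow> 'b \<Rightarrow> 'z::real_vector) \<Rightarrow> ('a \<times> 'b) list \<Rightarrow> 'z" where
  "tensor_sum b xs = (\<Sum>(x, y)\<leftarrow>xs. b x y)"

text \<open>
  A list \<open>[(x\<^sub>1, y\<^sub>1), \<dots>, (x\<^sub>n, y\<^sub>n)]\<close> represents the element
  \<open>x\<^sub>1 \<otimes> y\<^sub>1 + \<dots> + x\<^sub>n \<otimes> y\<^sub>n\<close> of the algebraic tensor product. Two lists represent the same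
  element iff all (not necessarily bounded) bilinear forms agree on them.
\<close>

definition same_tensor ::
    "('k::real_or_complex \<Rightarrow> 'a::real_normed_vector \<Rightarrow> 'a) \<Rightarrow> 'a set \<Rightarrow>
     ('k \<Rightarrow> 'b::real_normed_vector \<Rightarrow> 'b) \<Rightarrow> 'b set \<Rightarrow> ('a \<times> 'b) list \<Rightarrow> ('a \<times> 'b) list \<Rightarrow> bool" where
  "same_tensor sX S sY T xs ys \<longleftrightarrow>
     (\<forall>b :: 'a \<Rightarrow> 'b \<Rightarrow> 'k. bilinear_over sX S sY T (*) b \<longrightarrow> tensor_sum b xs = tensor_sum b ys)"

definition projective_norm ::
    "('k::real_or_complex \<Rightarrow> 'a::real_normed_vector \<Rightarrow> 'a) \<Rightarrow> 'a set \<Rightarrow>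
     ('k \<Rightarrow> 'b::real_normed_vector \<Rightarrow> 'b) \<Rightarrow> 'b set \<Rightarrow> ('a \<times> 'b) list \<Rightarrow> real" where
  "projective_norm sX S sY T xs =
     Inf {(\<Sum>(x, y)\<leftarrow>ys. norm x * norm y) | ys. set ys \<subseteq> S \<times> T \<and> same_tensor sX S sY T xs ys}"

text \<open>
  The Banach space \<open>'z\<close> with scalar multiplication \<open>sZ\<close> and the map \<open>(x, y) \<mapsto> t x y\<close> is a
  completion of the algebraic tensor product of \<open>S\<close> and \<open>T\<close> under the projective norm. Since
  the projective norm is definite, the norm condition makes the linear map from the algebraic
  tensor product to \<open>'z\<close> induced by \<open>t\<close> well defined, injective and isometric. Such a completion
  is unique up to an isometric isomorphism that respects \<open>t\<close>.
\<close>

definition completed_projective_tensor_product ::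
    "('k::real_or_complex \<Rightarrow> 'a::real_normed_vector \<Rightarrow> 'a) \<Rightarrow> 'a set \<Rightarrow>
     ('k \<Rightarrow> 'b::real_normed_vector \<Rightarrow> 'b) \<Rightarrow> 'b set \<Rightarrow>
     ('k \<Rightarrow> 'z::banach \<Rightarrow> 'z) \<Rightarrow> ('a \<Rightarrow> 'b \<Rightarrow> 'z) \<Rightarrow> bool" where
  "completed_projective_tensor_product sX S sY T sZ t \<longleftrightarrow>
     normed_space_over sZ \<and>
     bilinear_over sX S sY T sZ t \<and>
     (\<forall>xs. set xs \<subseteq> S \<times> T \<longrightarrow> norm (tensor_sum t xs) = projective_norm sX S sY T xs) \<and>
     closure {tensor_sum t xs | xs. set xs \<subseteq> S \<times> T} = UNIV"


section \<open>The Bochner integral\<close>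

text \<open>
  The library's \<open>has_bochner_integral\<close> is restricted to second countable (hence separable)
  spaces; the following makes no such assumption. The measures considered are finite, so every
  simple function is integrable.
\<close>

definition bochner_integrable_on :: "'a measure \<Rightarrow> ('a \<Rightarrow> 'z::banach) \<Rightarrow> bool" where
  "bochner_integrable_on M f \<longleftrightarrow>
     (\<exists>s. (\<forall>i::nat. simple_function M (s i)) \<and> (AE x in M. (\<lambda>i. s i x) \<longlonglongrightarrow> f x)) \<and>
     (\<integral>\<^sup>+ x. ennreal (norm (f x)) \<partial>M) < \<infinity>"

definition has_bochner_value :: "'a measure \<Rightarrow> ('a \<Rightarrow> 'z::banach) \<Rightarrow> 'z \<Rightarrow> bool" where
  "has_bochner_value M f u \<longleftrightarrow>
     (\<exists>s. (\<forall>i::nat. simple_function M (s i)) \<and>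
        (\<lambda>i. \<integral>\<^sup>+ x. ennreal (norm (f x - s i x)) \<partial>M) \<longlonglongrightarrow> 0 \<and>
        (\<lambda>i. Bochner_Integration.simple_bochner_integral M (s i)) \<longlonglongrightarrow> u)"


section \<open>Integral norm-attaining tensors\<close>

definition is_borel_measure :: "'a topology \<Rightarrow> 'a measure \<Rightarrow> bool" where
  "is_borel_measure \<tau> \<mu> \<longleftrightarrow>
     space \<mu> = topspace \<tau> \<and> sets \<mu> = sigma_sets (topspace \<tau>) {U. openin \<tau> U}"

definition INA :: "('a \<times> 'b) topology \<Rightarrow> ('a \<Rightarrow> 'b \<Rightarrow> 'z::banach) \<Rightarrow> 'z set" where
  "INA \<tau> t = {u. \<exists>\<mu>. is_borel_measure \<tau> \<mu> \<and> finite_measure \<mu> \<and>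
     bochner_integrable_on \<mu> (\<lambda>(x, y). t x y) \<and>
     has_bochner_value \<mu> (\<lambda>(x, y). t x y) u \<and>
     measure \<mu> (space \<mu>) = norm u}"

definition INA_norm ::
    "'a::real_normed_vector set \<Rightarrow> 'b::real_normed_vector set \<Rightarrow> ('a \<Rightarrow> 'b \<Rightarrow> 'z::banach) \<Rightarrow> 'z set" where
  "INA_norm S T t = INA (ball_product (norm_topology S) (norm_topology T)) t"

definition INA_weak ::
    "('k::real_or_complex \<Rightarrow> 'a::real_normed_vector \<Rightarrow> 'a) \<Rightarrow> 'a set \<Rightarrow>
     ('k \<Rightarrow> 'b::real_normed_vector \<Rightarrow> 'b) \<Rightarrow> 'b set \<Rightarrow> ('a \<Rightarrow> 'b \<Rightarrow> 'z::banach) \<Rightarrow> 'z set" where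
  "INA_weak sX S sY T t = INA (ball_product (weak_topology sX S) (weak_topology sY T)) t"

definition INA_weak_star ::
    "('k::real_or_complex \<Rightarrow> 'a::real_normed_vector \<Rightarrow> 'a) \<Rightarrow> ('k \<Rightarrow> 'b::real_normed_vector \<Rightarrow> 'b) \<Rightarrow>
     (('a \<Rightarrow>\<^sub>L 'k) \<Rightarrow> ('b \<Rightarrow>\<^sub>L 'k) \<Rightarrow> 'z::banach) \<Rightarrow> 'z set" where
  "INA_weak_star sX sY t = INA (ball_product (weak_star_topology sX) (weak_star_topology sY)) t"

end

theory Submission
  imports Defs
begin

text \<open>
  If \<open>u = \<integral> x \<otimes> y d\<mu>\<close> with \<open>\<parallel>\<mu>\<parallel> = \<parallel>u\<parallel>\<close>, then \<open>x \<otimes> y \<noteq> 0\<close> almost everywhere, and by strong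
  measurability \<open>x \<otimes> y\<close> lies almost everywhere in a separable set. Slicing with functionals,
  \<open>\<parallel>g(y) x - g(y') x'\<parallel> \<le> \<parallel>x \<otimes> y - x' \<otimes> y'\<parallel>\<close> for \<open>\<parallel>g\<parallel> \<le> 1\<close>, shows that then \<open>x\<close> and \<open>y\<close>
  themselves lie in norm separable sets. In the weak and weak-star topologies closed balls are closed,
  so a set of the form \<open>closure C\<close> with \<open>C\<close> countable, being
  \<open>\<Inter>n. \<Union>c\<in>C. cball c (1 / n)\<close>, is Borel, and on it these topologies have the same Borel sets as the norm
  topology. Hence \<open>\<mu>\<close> is concentrated on a set where the Borel structures coincide, and it can be
  restricted or extended from one of them to the other.
\<close>

section \<open>Measures on nested sigma-algebras with the same trace on a conull set\<close>

text \<open>In the application \<open>M\<close> lives on the Borel sets of the coarse topology and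
  \<open>N\<close> on those of the norm topology. The setting serves both inclusions: in one
  \<open>N\<close> is built from \<open>M\<close>, in the other \<open>M\<close> from
  \<open>N\<close>.\<close>

locale conull_trace =
  fixes M N :: "'a measure" and D :: "'a set"
  assumes space_eq: "space N = space M"
    and sets_le: "sets M \<subseteq> sets N"
    and emeasure_eq: "\<And>A. A \<in> sets M \<Longrightarrow> emeasure N A = emeasure M A"
    and D_sets: "D \<in> sets M"
    and D_conull: "emeasure M (space M - D) = 0"
    and trace: "\<And>B. B \<in> sets N \<Longrightarrow> B \<inter> D \<in> sets M"
begin

lemma AE_in_D: "AE x in M. x \<in> D"
  by (rule AE_I[of _ _ "space M - D"]) (use D_sets D_conull in auto)

text \<open>An exceptional set of \<open>N\<close> need not be measurable for \<open>M\<close>, but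
  its part in \<open>D\<close> is, by \<open>trace\<close>, and what lies outside \<open>D\<close>
  is null anyway.\<close>

lemma AE_eq: "(AE x in N. P x) \<longleftrightarrow> (AE x in M. P x)"
proof
  assume "AE x in M. P x"
  then obtain A where "{x \<in> space M. \<not> P x} \<subseteq> A" "emeasure M A = 0" "A \<in> sets M"
    by (rule AE_E)
  then show "AE x in N. P x"
    using sets_le emeasure_eq space_eq by (intro AE_I[of _ _ A]) auto
next
  assume "AE x in N. P x"
  then obtain B where B: "{x \<in> space N. \<not> P x} \<subseteq> B" "emeasure N B = 0" "B \<in> sets N"
    by (rule AE_E)
  have "emeasure M (B \<inter> D) = emeasure N (B \<inter> D)"
    using trace B(3) emeasure_eq by auto
  also have "\<dots> \<le> emeasure N B"
    using B(3) by (intro emeasure_mono) auto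
  finally have "emeasure M (B \<inter> D) = 0"
    using B(2) by simp
  then have "AE x in M. x \<notin> B \<inter> D"
    by (intro AE_not_in null_setsI trace B(3))
  then show "AE x in M. P x"
    using AE_in_D AE_space by eventually_elim (use B(1) space_eq in auto)
qed

lemma AE_in_D': "AE x in N. x \<in> D"
  using AE_in_D AE_eq by blast

lemma simple_function_large: "simple_function M f \<Longrightarrow> simple_function N f"
  using simple_function_subalgebra sets_le space_eq by metis

text \<open>Only the traces on \<open>D\<close> of the level sets of \<open>f\<close> are known to
  lie in \<open>M\<close>, so \<open>f\<close> is overwritten by a constant off \<open>D\<close>.
  That changes it on a null set only.\<close>

lemma simple_function_small:
  assumes "simple_function N f"
  shows "simple_function M (\<lambda>x. if x \<in> D then f x else c)"
  unfolding simple_function_def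
proof (intro conjI ballI)
  have "finite (f ` space M)"
    using assms space_eq by (auto simp: simple_function_def)
  moreover have "(\<lambda>x. if x \<in> D then f x else c) ` space M \<subseteq> insert c (f ` space M)"
    by auto
  ultimately show "finite ((\<lambda>x. if x \<in> D then f x else c) ` space M)"
    using finite_subset finite.insertI by metis
next
  fix y
  have "(f -` {y} \<inter> space N) \<inter> D \<in> sets M"
    using assms by (intro trace simple_functionD)
  moreover have "(\<lambda>x. if x \<in> D then f x else c) -` {y} \<inter> space M =
    ((f -` {y} \<inter> space N) \<inter> D) \<union> (if y = c then space M - D else {})"
    by (auto simp: space_eq split: if_splits)
  ultimately show "(\<lambda>x. if x \<in> D then f x else c) -` {y} \<inter> space M \<in> sets M"
    using D_sets by auto
qed

lemma simple_integral_eq: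
  assumes "simple_function M f"
  shows "integral\<^sup>S N f = integral\<^sup>S M f"
  unfolding simple_integral_def space_eq
  using assms by (auto intro!: sum.cong simp: emeasure_eq simple_functionD)

text \<open>For a non-measurable \<open>f\<close> the library's integral is the lower integral.\<close>

lemma nn_integral_eq: "integral\<^sup>N N f = integral\<^sup>N M f"
  unfolding nn_integral_def
proof (safe intro!: antisym SUP_least)
  fix g assume g: "simple_function M g" "g \<le> f"
  then show "integral\<^sup>S M g \<le> (SUP g\<in>{g. simple_function N g \<and> g \<le> f}. integral\<^sup>S N g)"
    using simple_integral_eq[OF g(1)] simple_function_large[OF g(1)]
    by (intro SUP_upper2[of g]) auto
next
  fix g assume g: "simple_function N g" "g \<le> f"
  \<comment> \<open>The default value 0 keeps \<open>?h\<close> below \<open>f\<close>, whatever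
    \<open>f\<close> is off \<open>D\<close>.\<close>
  let ?h = "\<lambda>x. if x \<in> D then g x else 0"
  have h: "simple_function M ?h"
    by (rule simple_function_small[OF g(1)])
  have "integral\<^sup>S N g = integral\<^sup>S N ?h"
    using AE_in_D' by (intro simple_integral_cong_AE g simple_function_large h) auto
  also have "\<dots> = integral\<^sup>S M ?h"
    by (rule simple_integral_eq[OF h])
  finally show "integral\<^sup>S N g \<le> (SUP g\<in>{g. simple_function M g \<and> g \<le> f}. integral\<^sup>S M g)"
    using h g(2) by (intro SUP_upper2[of ?h]) (auto simp: le_fun_def)
qed

lemma simple_bochner_integral_large:
  assumes "simple_function M f"
  shows "Bochner_Integration.simple_bochner_integral N f = Bochner_Integration.simple_bochner_integral M f"
  unfolding simple_bochner_integral_def space_eq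
proof (rule sum.cong[OF refl])
  fix y
  have "{x \<in> space M. f x = y} = f -` {y} \<inter> space M" by auto
  then have "{x \<in> space M. f x = y} \<in> sets M"
    using assms by (simp add: simple_functionD)
  then show "measure N {x \<in> space M. f x = y} *\<^sub>R y = measure M {x \<in> space M. f x = y} *\<^sub>R y"
    by (simp add: measure_def emeasure_eq)
qed

lemma simple_bochner_integral_small:
  assumes "simple_function N f"
  shows "Bochner_Integration.simple_bochner_integral M (\<lambda>x. if x \<in> D then f x else 0) = Bochner_Integration.simple_bochner_integral N f"
proof -
  let ?h = "\<lambda>x. if x \<in> D then f x else 0"
  have h: "simple_function M ?h"
    by (rule simple_function_small[OF assms])
  have fin: "finite (f ` space N \<union> {0})" "finite (?h ` space N \<union> {0})"
    using assms h space_eq by (auto simp: simple_function_def)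
  have meas: "{x \<in> space N. f x = y} \<in> sets N" "{x \<in> space N. ?h x = y} \<in> sets N" for y
  proof -
    have "{x \<in> space N. f x = y} = f -` {y} \<inter> space N" by auto
    then show "{x \<in> space N. f x = y} \<in> sets N"
      using assms by (simp add: simple_functionD)
    have "{x \<in> space N. ?h x = y} = ?h -` {y} \<inter> space N" by auto
    then show "{x \<in> space N. ?h x = y} \<in> sets N"
      using simple_function_large[OF h] by (simp only: simple_functionD)
  qed
  have eq: "measure N {x \<in> space N. ?h x = y} = measure N {x \<in> space N. f x = y}" for y
    unfolding measure_def
    using AE_in_D' by (intro arg_cong[of _ _ enn2real] emeasure_eq_AE meas) auto
  have large: "Bochner_Integration.simple_bochner_integral N k =
      (\<Sum>y\<in>f ` space N \<union> {0}. measure N {x \<in> space N. k x = y} *\<^sub>R y)"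
    if "k ` space N \<subseteq> f ` space N \<union> {0}" for k :: "'a \<Rightarrow> 'b"
    unfolding simple_bochner_integral_def
  proof (rule sum.mono_neutral_left[OF fin(1) that], rule ballI)
    fix y assume "y \<in> f ` space N \<union> {0} - k ` space N"
    then have "{x \<in> space N. k x = y} = {}" by auto
    then show "measure N {x \<in> space N. k x = y} *\<^sub>R y = 0"
      by (simp only: measure_empty scaleR_zero_left)
  qed
  have "Bochner_Integration.simple_bochner_integral M ?h = Bochner_Integration.simple_bochner_integral N ?h"
    by (rule simple_bochner_integral_large[OF h, symmetric])
  also have "\<dots> = (\<Sum>y\<in>f ` space N \<union> {0}. measure N {x \<in> space N. ?h x = y} *\<^sub>R y)"
    by (rule large) auto
  also have "\<dots> = Bochner_Integration.simple_bochner_integral N f"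
    unfolding eq by (rule large[symmetric]) auto
  finally show ?thesis .
qed

lemma bochner_integrable_on_eq: "bochner_integrable_on N f \<longleftrightarrow> bochner_integrable_on M f"
proof
  assume "bochner_integrable_on M f"
  then show "bochner_integrable_on N f"
    unfolding bochner_integrable_on_def AE_eq nn_integral_eq
    using simple_function_large by blast
next
  assume N: "bochner_integrable_on N f"
  then obtain s where s: "\<And>i::nat. simple_function N (s i)" "AE x in M. (\<lambda>i. s i x) \<longlonglongrightarrow> f x"
    unfolding bochner_integrable_on_def AE_eq by blast
  have "AE x in M. (\<lambda>i. if x \<in> D then s i x else 0) \<longlonglongrightarrow> f x"
    using s(2) AE_in_D by eventually_elim simp
  then show "bochner_integrable_on M f"
    using N simple_function_small[OF s(1)]
    unfolding bochner_integrable_on_def nn_integral_eq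
    by (intro conjI exI[of _ "\<lambda>i x. if x \<in> D then s i x else 0"]) auto
qed

lemma has_bochner_value_eq: "has_bochner_value N f u \<longleftrightarrow> has_bochner_value M f u"
proof
  assume "has_bochner_value M f u"
  then obtain s where s: "\<And>i::nat. simple_function M (s i)"
      "(\<lambda>i. \<integral>\<^sup>+ x. ennreal (norm (f x - s i x)) \<partial>M) \<longlonglongrightarrow> 0"
      "(\<lambda>i. Bochner_Integration.simple_bochner_integral M (s i)) \<longlonglongrightarrow> u"
    unfolding has_bochner_value_def by blast
  then show "has_bochner_value N f u"
    unfolding has_bochner_value_def nn_integral_eq
    by (intro exI[of _ s]) (simp add: simple_function_large simple_bochner_integral_large)
next
  assume "has_bochner_value N f u"
  then obtain s where s: "\<And>i::nat. simple_function N (s i)"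
      "(\<lambda>i. \<integral>\<^sup>+ x. ennreal (norm (f x - s i x)) \<partial>M) \<longlonglongrightarrow> 0"
      "(\<lambda>i. Bochner_Integration.simple_bochner_integral N (s i)) \<longlonglongrightarrow> u"
    unfolding has_bochner_value_def nn_integral_eq by blast
  let ?s = "\<lambda>i x. if x \<in> D then s i x else 0"
  have "(\<integral>\<^sup>+ x. ennreal (norm (f x - ?s i x)) \<partial>M) = (\<integral>\<^sup>+ x. ennreal (norm (f x - s i x)) \<partial>M)" for i
    using AE_in_D by (intro nn_integral_cong_AE) auto
  then show "has_bochner_value M f u"
    unfolding has_bochner_value_def
    using s by (intro exI[of _ ?s]) (simp add: simple_function_small simple_bochner_integral_small)
qed

lemma norm_attaining_eq:
  "bochner_integrable_on M f \<and> has_bochner_value M f u \<and> measure M (space M) = norm u \<longleftrightarrow>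
   bochner_integrable_on N f \<and> has_bochner_value N f u \<and> measure N (space N) = norm u"
proof -
  have "measure N (space N) = measure M (space M)"
    by (simp add: measure_def space_eq emeasure_eq)
  then show ?thesis
    by (simp add: bochner_integrable_on_eq has_bochner_value_eq)
qed

end

lemma emeasure_compl_eq_0:
  assumes "AE p in \<mu>. p \<in> A" "A \<in> sets \<mu>"
  shows "emeasure \<mu> (space \<mu> - A) = 0"
proof -
  have "{p \<in> space \<mu>. p \<notin> A} = space \<mu> - A" by auto
  then show ?thesis
    using assms AE_iff_measurable[of "space \<mu> - A" \<mu> "\<lambda>p. p \<in> A"] by auto
qed

section \<open>The vanishing set of a norm-attaining integrand\<close>

lemma norm_simple_bochner_integral_le:
  assumes "finite_measure M" "simple_function M f"
  shows "ennreal (norm (Bochner_Integration.simple_bochner_integral M f)) \<le> (\<integral>\<^sup>+ x. ennreal (norm (f x)) \<partial>M)"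
proof -
  interpret finite_measure M by fact
  have f: "Bochner_Integration.simple_bochner_integrable M f"
    using assms(2) by (rule simple_bochner_integrable.intros) simp
  have "Bochner_Integration.simple_bochner_integrable M (\<lambda>x. norm (f x))"
    by (rule simple_bochner_integrable.intros) (auto intro: simple_function_compose1 assms(2))
  then have "ennreal (Bochner_Integration.simple_bochner_integral M (\<lambda>x. norm (f x))) = (\<integral>\<^sup>+ x. ennreal (norm (f x)) \<partial>M)"
    by (rule simple_bochner_integral_eq_nn_integral) simp
  then show ?thesis
    using simple_bochner_integral_norm_bound[OF f] by (metis ennreal_leI)
qed

text \<open>The norm of the integrand is at most the indicator of the complement of
  \<open>E\<close>. The bound is proved for the approximating simple functions up to their error and
  passes to the limit.\<close>

lemma has_bochner_value_norm_le:
  assumes fin: "finite_measure M" and f: "has_bochner_value M f u"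
    and E: "E \<in> sets M" "\<And>x. x \<in> E \<Longrightarrow> f x = 0" "\<And>x. x \<in> space M \<Longrightarrow> norm (f x) \<le> 1"
  shows "norm u \<le> measure M (space M - E)"
proof -
  interpret finite_measure M by fact
  obtain s where s: "\<And>i::nat. simple_function M (s i)"
      "(\<lambda>i. \<integral>\<^sup>+ x. ennreal (norm (f x - s i x)) \<partial>M) \<longlonglongrightarrow> 0"
      "(\<lambda>i. Bochner_Integration.simple_bochner_integral M (s i)) \<longlonglongrightarrow> u"
    using f unfolding has_bochner_value_def by blast
  \<comment> \<open>The excess of the approximant over its bound is measurable, unlike \<open>f\<close> itself; this gives
    subadditivity of the integral.\<close>
  define k :: "nat \<Rightarrow> 'a \<Rightarrow> real" where "k i x = max 0 (norm (s i x) - indicator (space M - E) x)" for i x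
  have [measurable]: "(\<lambda>x. norm (s i x)) \<in> borel_measurable M" for i
    by (rule borel_measurable_simple_function[OF simple_function_compose1[OF s(1)]])
  have [measurable]: "k i \<in> borel_measurable M" for i
    unfolding k_def using E(1) by measurable
  have k_le: "k i x \<le> norm (f x - s i x)" if "x \<in> space M" for i x
  proof (cases "x \<in> E")
    case True
    then show ?thesis using E(2) by (simp add: k_def)
  next
    case False
    have "norm (s i x) \<le> norm (f x) + norm (f x - s i x)"
      by (metis norm_minus_commute norm_triangle_sub)
    then show ?thesis using False that E(3)[OF that] by (simp add: k_def)
  qed
  have bound: "ennreal (norm (Bochner_Integration.simple_bochner_integral M (s i)))
      \<le> emeasure M (space M - E) + (\<integral>\<^sup>+ x. ennreal (norm (f x - s i x)) \<partial>M)" for i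
  proof -
    have "ennreal (norm (Bochner_Integration.simple_bochner_integral M (s i))) \<le> (\<integral>\<^sup>+ x. ennreal (norm (s i x)) \<partial>M)"
      by (rule norm_simple_bochner_integral_le[OF fin s(1)])
    also have "\<dots> \<le> (\<integral>\<^sup>+ x. indicator (space M - E) x + ennreal (k i x) \<partial>M)"
    proof (rule nn_integral_mono)
      fix x
      have "ennreal (norm (s i x)) \<le> ennreal (indicator (space M - E) x + k i x)"
        by (rule ennreal_leI) (auto simp: k_def)
      then show "ennreal (norm (s i x)) \<le> indicator (space M - E) x + ennreal (k i x)"
        by (simp add: ennreal_plus k_def ennreal_indicator)
    qed
    also have "\<dots> = emeasure M (space M - E) + (\<integral>\<^sup>+ x. ennreal (k i x) \<partial>M)"
      using E(1) by (subst nn_integral_add) auto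
    also have "\<dots> \<le> emeasure M (space M - E) + (\<integral>\<^sup>+ x. ennreal (norm (f x - s i x)) \<partial>M)"
      by (intro add_left_mono nn_integral_mono ennreal_leI k_le)
    finally show ?thesis .
  qed
  have "(\<lambda>i. emeasure M (space M - E) + (\<integral>\<^sup>+ x. ennreal (norm (f x - s i x)) \<partial>M))
      \<longlonglongrightarrow> emeasure M (space M - E) + 0"
    by (intro tendsto_add tendsto_const s(2))
  moreover have "(\<lambda>i. ennreal (norm (Bochner_Integration.simple_bochner_integral M (s i)))) \<longlonglongrightarrow> ennreal (norm u)"
    by (intro tendsto_ennrealI tendsto_norm s(3))
  ultimately have "ennreal (norm u) \<le> emeasure M (space M - E) + 0"
    using bound by (intro LIMSEQ_le[where X = "\<lambda>i. ennreal (norm (Bochner_Integration.simple_bochner_integral M (s i)))"]) blast+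
  then show ?thesis
    by (simp add: emeasure_eq_measure)
qed

text \<open>Mass on \<open>E\<close> would be wasted: attaining the norm forces the total mass to be
  at most the mass of the complement of \<open>E\<close>.\<close>

lemma has_bochner_value_AE_nonzero:
  assumes fin: "finite_measure M" and f: "has_bochner_value M f u"
    and E: "E \<in> sets M" "\<And>x. x \<in> E \<Longrightarrow> f x = 0" "\<And>x. x \<in> space M \<Longrightarrow> norm (f x) \<le> 1"
    and u: "measure M (space M) = norm u"
  shows "AE x in M. x \<notin> E"
proof -
  interpret finite_measure M by fact
  have "measure M (space M - E) = measure M (space M) - measure M E"
    using E(1) by (rule finite_measure_compl)
  then have "measure M E = 0"
    using has_bochner_value_norm_le[OF fin f E] u measure_nonneg[of M E] by linarith
  then have "emeasure M E = 0"
    by (simp add: emeasure_eq_measure)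
  then show ?thesis
    using E(1) by (intro AE_not_in null_setsI)
qed
section \<open>The Hahn--Banach theorem\<close>

definition sublinear :: "('a::real_vector \<Rightarrow> real) \<Rightarrow> bool" where
  "sublinear p \<longleftrightarrow> (\<forall>x y. p (x + y) \<le> p x + p y) \<and> (\<forall>r>0. \<forall>x. p (r *\<^sub>R x) = r * p x)"

lemma sublinear_add: "sublinear p \<Longrightarrow> p (x + y) \<le> p x + p y"
  by (simp add: sublinear_def)

lemma sublinear_scaleR: "sublinear p \<Longrightarrow> r > 0 \<Longrightarrow> p (r *\<^sub>R x) = r * p x"
  by (simp add: sublinear_def)

lemma sublinear_zero: "sublinear p \<Longrightarrow> p 0 = 0"
  using sublinear_scaleR[of p 2 0] by simp

lemma sublinear_scaleR_nonneg: "sublinear p \<Longrightarrow> r \<ge> 0 \<Longrightarrow> p (r *\<^sub>R x) = r * p x"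
  by (cases "r = 0") (auto simp: sublinear_zero sublinear_scaleR)

lemma sublinear_minus: "sublinear p \<Longrightarrow> - p (- x) \<le> p x"
  using sublinear_add[of p x "- x"] sublinear_zero[of p] by simp

lemma sublinear_norm: "sublinear norm"
  by (simp add: sublinear_def norm_triangle_ineq)

text \<open>The \<open>q i\<close> need not be sublinear one by one; it suffices that sums and
  positive multiples are absorbed by some other index. This covers both the infimum along a ray and
  the infimum of a chain.\<close>

lemma sublinear_INF:
  assumes ne: "I \<noteq> {}"
    and add: "\<And>i j x y. i \<in> I \<Longrightarrow> j \<in> I \<Longrightarrow> \<exists>k\<in>I. q k (x + y) \<le> q i x + q j y"
    and scale: "\<And>i r x. i \<in> I \<Longrightarrow> r > 0 \<Longrightarrow> \<exists>k\<in>I. q k (r *\<^sub>R x) \<le> r * q i x"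
    and bdd: "\<And>x. bdd_below ((\<lambda>i. q i x) ` I)"
  shows "sublinear (\<lambda>x. INF i\<in>I. q i x :: real)"
  unfolding sublinear_def
proof (intro conjI allI impI)
  fix x y
  have *: "(INF i\<in>I. q i (x + y)) \<le> q i x + q j y" if ij: "i \<in> I" "j \<in> I" for i j
    using add[OF ij, of x y] bdd by (meson cINF_lower2)
  have "(INF i\<in>I. q i (x + y)) - q i x \<le> (INF j\<in>I. q j y)" if i: "i \<in> I" for i
  proof (rule cINF_greatest[OF ne])
    fix j assume "j \<in> I"
    then show "(INF i\<in>I. q i (x + y)) - q i x \<le> q j y"
      using *[OF i] by force
  qed
  then have "(INF i\<in>I. q i (x + y)) - (INF j\<in>I. q j y) \<le> (INF i\<in>I. q i x)"
    by (intro cINF_greatest[OF ne]) force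
  then show "(INF i\<in>I. q i (x + y)) \<le> (INF i\<in>I. q i x) + (INF i\<in>I. q i y)"
    by simp
next
  have le: "(INF i\<in>I. q i (r *\<^sub>R x)) \<le> r * (INF i\<in>I. q i x)" if r: "r > 0" for r x
  proof -
    have "(INF i\<in>I. q i (r *\<^sub>R x)) / r \<le> (INF i\<in>I. q i x)"
    proof (rule cINF_greatest[OF ne])
      fix i assume "i \<in> I"
      then have "(INF i\<in>I. q i (r *\<^sub>R x)) \<le> r * q i x"
        using scale[OF _ r] bdd by (meson cINF_lower2)
      then show "(INF i\<in>I. q i (r *\<^sub>R x)) / r \<le> q i x"
        using r by (simp add: field_simps)
    qed
    then show ?thesis
      using r by (simp add: field_simps)
  qed
  fix r :: real and x assume r: "r > 0"
  \<comment> \<open>The reverse inequality is \<open>le\<close> for the factor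
    \<open>inverse r\<close> at the vector \<open>r *\<^sub>R x\<close>.\<close>
  have "(INF i\<in>I. q i (inverse r *\<^sub>R (r *\<^sub>R x))) \<le> inverse r * (INF i\<in>I. q i (r *\<^sub>R x))"
    using r by (intro le) simp
  then have "r * (INF i\<in>I. q i x) \<le> (INF i\<in>I. q i (r *\<^sub>R x))"
    using r by (simp add: field_simps)
  then show "(INF i\<in>I. q i (r *\<^sub>R x)) = r * (INF i\<in>I. q i x)"
    using le[OF r] by (intro antisym)
qed

text \<open>Take the infimum of \<open>p (x + t *\<^sub>R y) - t * p y\<close> over
  \<open>t \<ge> 0\<close>: the value at \<open>t = 0\<close> gives the first bound and that at
  \<open>t = 1\<close> the second. Subadditivity of \<open>p\<close> bounds the infimum below by
  \<open>- p (- x)\<close>.\<close>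

lemma sublinear_lowering:
  fixes p :: "'a::real_vector \<Rightarrow> real"
  assumes p: "sublinear p"
  obtains q where "sublinear q" "\<And>x. q x \<le> p x" "\<And>x. q x \<le> p (x + y) - p y"
proof
  let ?q = "\<lambda>x. INF t\<in>{0..}. p (x + t *\<^sub>R y) - t * p y"
  have bdd: "bdd_below ((\<lambda>t. p (x + t *\<^sub>R y) - t * p y) ` {0..})" for x
  proof (rule bdd_belowI2)
    fix t :: real assume "t \<in> {0..}"
    then have "t * p y = p ((x + t *\<^sub>R y) + (- x))"
      using sublinear_scaleR_nonneg[OF p] by simp
    also have "\<dots> \<le> p (x + t *\<^sub>R y) + p (- x)"
      by (rule sublinear_add[OF p])
    finally show "- p (- x) \<le> p (x + t *\<^sub>R y) - t * p y" by simp
  qed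
  show "sublinear ?q"
  proof (rule sublinear_INF)
    fix i j :: real and x x' assume "i \<in> {0..}" "j \<in> {0..}"
    then show "\<exists>k\<in>{0..}. p (x + x' + k *\<^sub>R y) - k * p y \<le> p (x + i *\<^sub>R y) - i * p y + (p (x' + j *\<^sub>R y) - j * p y)"
      using sublinear_add[OF p, of "x + i *\<^sub>R y" "x' + j *\<^sub>R y"]
      by (intro bexI[of _ "i + j"]) (auto simp: algebra_simps)
  next
    fix i r :: real and x assume "i \<in> {0..}" "r > 0"
    then show "\<exists>k\<in>{0..}. p (r *\<^sub>R x + k *\<^sub>R y) - k * p y \<le> r * (p (x + i *\<^sub>R y) - i * p y)"
      using sublinear_scaleR[OF p, of r "x + i *\<^sub>R y"]
      by (intro bexI[of _ "r * i"]) (auto simp: algebra_simps)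
  qed (use bdd in auto)
  show "?q x \<le> p x" for x
    using cINF_lower[OF bdd, of 0 x] by simp
  show "?q x \<le> p (x + y) - p y" for x
    using cINF_lower[OF bdd, of 1 x] by simp
qed

text \<open>Zorn's lemma for the reversed order. A nonempty chain has its pointwise infimum as a
  lower bound; it is finite because \<open>f \<le> p\<close> implies
  \<open>- p (- x) \<le> f x\<close> for sublinear \<open>f\<close>.\<close>

lemma minimal_sublinear_exists:
  fixes p :: "'a::real_vector \<Rightarrow> real"
  assumes p: "sublinear p"
  obtains m where "sublinear m" "m \<le> p" "\<And>q. sublinear q \<Longrightarrow> q \<le> m \<Longrightarrow> q = m"
proof -
  let ?A = "{q. sublinear q \<and> q \<le> p}" and ?P = "\<lambda>f g :: 'a \<Rightarrow> real. g \<le> f"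
  have "\<exists>m\<in>?A. \<forall>a\<in>?A. ?P m a \<longrightarrow> a = m"
  proof (rule predicate_Zorn)
    show "partial_order_on ?A (relation_of ?P ?A)"
      by (rule partial_order_on_relation_ofI) auto
  next
    fix C assume C: "C \<in> Chains (relation_of ?P ?A)"
    have CA: "C \<subseteq> ?A"
      by (rule Chains_relation_of[OF C])
    have chain: "f \<le> g \<or> g \<le> f" if "f \<in> C" "g \<in> C" for f g
      using C that by (auto simp: Chains_def relation_of_def)
    show "\<exists>u\<in>?A. \<forall>a\<in>C. u \<le> a"
    proof (cases "C = {}")
      case True
      then show ?thesis using p by auto
    next
      case False
      let ?u = "\<lambda>x. INF f\<in>C. f x"
      have bdd: "bdd_below ((\<lambda>f. f x) ` C)" for x
      proof (rule bdd_belowI2)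
        fix f assume "f \<in> C"
        then have "sublinear f" "f (- x) \<le> p (- x)"
          using CA by (auto simp: le_fun_def)
        then show "- p (- x) \<le> f x"
          using sublinear_minus[of f x] by simp
      qed
      have u_le: "?u x \<le> f x" if "f \<in> C" for f x
        by (rule cINF_lower[OF bdd that])
      have "sublinear ?u"
      proof (rule sublinear_INF[OF False])
        fix f g x y assume fg: "f \<in> C" "g \<in> C"
        then have "sublinear f" "sublinear g"
          using CA by auto
        show "\<exists>k\<in>C. k (x + y) \<le> f x + g y"
          using chain[OF fg]
        proof
          assume "f \<le> g"
          then have "f (x + y) \<le> f x + g y"
            using sublinear_add[OF \<open>sublinear f\<close>, of x y] le_funD[OF \<open>f \<le> g\<close>, of y] by linarith
          with fg show ?thesis by blast
        next
          assume "g \<le> f"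
          then have "g (x + y) \<le> f x + g y"
            using sublinear_add[OF \<open>sublinear g\<close>, of x y] le_funD[OF \<open>g \<le> f\<close>, of x] by linarith
          with fg show ?thesis by blast
        qed
      next
        fix f x and r :: real assume "f \<in> C" "r > 0"
        then show "\<exists>k\<in>C. k (r *\<^sub>R x) \<le> r * f x"
          using CA sublinear_scaleR[of f r x] by (intro bexI[of _ f]) auto
      qed (rule bdd)
      moreover have "?u \<le> p"
      proof -
        obtain f where f: "f \<in> C" using False by blast
        then have "f \<le> p" using CA by auto
        then show ?thesis using u_le[OF f] by (metis (mono_tags, lifting) le_funD le_funI order_trans)
      qed
      ultimately show ?thesis
        using u_le by (intro bexI[of _ ?u]) (auto simp: le_fun_def)
    qed
  qed
  then show ?thesis
  proof (rule bexE)
    fix m assume m: "m \<in> ?A" "\<forall>a\<in>?A. a \<le> m \<longrightarrow> a = m"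
    have "q = m" if "sublinear q" "q \<le> m" for q
    proof -
      have "q \<le> p" using that(2) m(1) order_trans by blast
      then show ?thesis using m(2) that by blast
    qed
    with m(1) show thesis by (intro that[of m]) auto
  qed
qed

text \<open>Lowering \<open>m\<close> in direction \<open>y\<close> returns \<open>m\<close> itself
  by minimality, and the bound gained is superadditivity. Negative factors follow from
  \<open>m (- x) = - m x\<close>.\<close>

lemma minimal_sublinear_linear:
  fixes m :: "'a::real_vector \<Rightarrow> real"
  assumes m: "sublinear m" "\<And>q. sublinear q \<Longrightarrow> q \<le> m \<Longrightarrow> q = m"
  shows "linear m"
proof -
  have add: "m (x + y) = m x + m y" for x y
  proof -
    obtain q where q: "sublinear q" "\<And>x. q x \<le> m x" "\<And>x. q x \<le> m (x + y) - m y"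
      using sublinear_lowering[OF m(1), of y] by blast
    have "q = m"
      using q by (intro m(2)) (auto simp: le_fun_def)
    then show ?thesis
      using q(3)[of x] sublinear_add[OF m(1), of x y] by simp
  qed
  have minus: "m (- x) = - m x" for x
    using add[of x "- x"] sublinear_zero[OF m(1)] by simp
  have "m (r *\<^sub>R x) = r *\<^sub>R m x" for r x
  proof (cases "r \<ge> 0")
    case True
    then show ?thesis using sublinear_scaleR_nonneg[OF m(1)] by simp
  next
    case False
    then have "m ((- r) *\<^sub>R x) = - r * m x"
      by (intro sublinear_scaleR_nonneg m) simp
    then show ?thesis using minus[of "r *\<^sub>R x"] by simp
  qed
  then show ?thesis
    using add by (intro linearI)
qed

lemma real_norming_functional:
  fixes x0 :: "'a::real_normed_vector"
  obtains g :: "'a \<Rightarrow> real" where "linear g" "\<And>x. g x \<le> norm x" "g x0 = norm x0"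
proof -
  \<comment> \<open>Lowering the norm in direction \<open>x0\<close> first gives
    \<open>p (- x0) \<le> - norm x0\<close>, so every linear functional below \<open>p\<close>
    attains the norm at \<open>x0\<close>.\<close>
  obtain p where p: "sublinear p" "\<And>x. p x \<le> norm x" "\<And>x. p x \<le> norm (x + x0) - norm x0"
    using sublinear_lowering[OF sublinear_norm, of x0] by blast
  obtain g where g: "sublinear g" "g \<le> p" "\<And>q. sublinear q \<Longrightarrow> q \<le> g \<Longrightarrow> q = g"
    using minimal_sublinear_exists[OF p(1)] by blast
  have lin: "linear g"
    using g by (intro minimal_sublinear_linear)
  have le: "g x \<le> norm x" for x
    using le_funD[OF g(2), of x] p(2)[of x] by linarith
  have "g (- x0) \<le> - norm x0"
    using le_funD[OF g(2), of "- x0"] p(3)[of "- x0"] by simp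
  then have "g x0 = norm x0"
    using le[of x0] linear_neg[OF lin, of x0] by simp
  with lin le show ?thesis
    by (rule that)
qed

section \<open>Norming functionals over real or complex scalars\<close>

text \<open>In the complex case \<open>R\<close> is the real part and \<open>j\<close> the imaginary unit; in the real case
  \<open>j = 0\<close>.\<close>

lemma real_or_complex_real_part:
  obtains R :: "'k::real_or_complex \<Rightarrow> real" and j :: 'k
  where "\<And>c. c = of_real (R c) - j * of_real (R (j * c))" "linear R" "\<And>c. \<bar>R c\<bar> \<le> norm c"
    "\<And>r. R (of_real r) = r" "j = 0 \<or> j * j = -1"
  using real_or_complex
proof (elim disjE exE conjE)
  fix h :: "'k \<Rightarrow> real"
  assume h: "bij h" "\<forall>x y. h (x + y) = h x + h y" "\<forall>x y. h (x * y) = h x * h y"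
    "\<forall>r x. h (r *\<^sub>R x) = r *\<^sub>R h x" "\<forall>x. norm (h x) = norm x"
  have inj: "h x = h y \<Longrightarrow> x = y" for x y
    using h(1) by (meson bij_is_inj injD)
  \<comment> \<open>That \<open>h\<close> preserves 1 is deduced: \<open>h 1\<close> is an
    idempotent of norm one.\<close>
  have "h 1 * h 1 = h 1" using h(3) by (metis mult_1)
  moreover have "norm (h 1) = 1" using h(5) by simp
  ultimately have h1: "h 1 = 1" by auto
  have real: "h (of_real r) = r" for r
    using h(4) h1 by (simp add: of_real_def)
  show thesis
  proof (rule that[of h 0])
    show "c = of_real (h c) - 0 * of_real (h (0 * c))" for c
      by (rule inj) (simp add: real)
    show "linear h" using h by (intro linearI) auto
  qed (use h(5) real in auto)
next
  fix h :: "'k \<Rightarrow> complex"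
  assume h: "bij h" "\<forall>x y. h (x + y) = h x + h y" "\<forall>x y. h (x * y) = h x * h y"
    "\<forall>r x. h (r *\<^sub>R x) = r *\<^sub>R h x" "\<forall>x. norm (h x) = norm x"
  have inj: "h x = h y \<Longrightarrow> x = y" for x y
    using h(1) by (meson bij_is_inj injD)
  have "h 1 * h 1 = h 1" using h(3) by (metis mult_1)
  moreover have "norm (h 1) = 1" using h(5) by simp
  ultimately have h1: "h 1 = 1" by auto
  have real: "h (of_real r) = of_real r" for r
    using h(4) h1 by (simp add: of_real_def)
  obtain j where j: "h j = \<i>" using h(1) by (metis bij_pointE)
  have lin: "linear h" using h by (intro linearI) auto
  have jj: "j * j = -1"
    by (rule inj) (simp add: h(3) j h1 linear_neg[OF lin])
  show thesis
  proof (rule that[of "\<lambda>c. Re (h c)" j])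
    \<comment> \<open>The real part of i times c is minus the imaginary part of c, so this is the
      decomposition into real and imaginary part.\<close>
    show "c = of_real (Re (h c)) - j * of_real (Re (h (j * c)))" for c
      by (rule inj) (simp add: linear_diff[OF lin] linear_add[OF lin] real h(3) j complex_eq_iff)
    show "linear (\<lambda>c. Re (h c))" using h by (intro linearI) auto
    show "\<bar>Re (h c)\<bar> \<le> norm c" for c using h(5) abs_Re_le_cmod by metis
  qed (use real jj in auto)
qed

text \<open>Complexification of a real norming functional \<open>g\<close>: the map
  \<open>f x = g x - j g (j x)\<close> is linear over the scalars and has real part
  \<open>g\<close>. Rotating \<open>f x\<close> to its absolute value reduces the bound on
  \<open>f\<close> to that on \<open>g\<close>. With \<open>j = 0\<close> the same formula covers
  real scalars.\<close>

lemma norming_functional: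
  fixes s :: "'k::real_or_complex \<Rightarrow> 'a::real_normed_vector \<Rightarrow> 'a" and x0 :: 'a
  assumes "normed_space_over s"
  obtains f where "f \<in> bounded_functionals s UNIV" "\<And>x. norm (f x) \<le> norm x" "norm x0 \<le> norm (f x0)"
proof -
  interpret normed_space_over s by fact
  obtain R :: "'k \<Rightarrow> real" and j :: 'k where R: "\<And>c. c = of_real (R c) - j * of_real (R (j * c))" "linear R"
      "\<And>c. \<bar>R c\<bar> \<le> norm c" "\<And>r. R (of_real r) = r" "j = 0 \<or> j * j = -1"
    by (rule real_or_complex_real_part, rule that)
  obtain g :: "'a \<Rightarrow> real" where g: "linear g" "\<And>x. g x \<le> norm x" "g x0 = norm x0"
    by (rule real_norming_functional[of x0], rule that)
  define f where "f x = of_real (g x) - j * of_real (g (s j x))" for x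
  have s_real: "s c (r *\<^sub>R x) = r *\<^sub>R s c x" for r c x
    by (metis scale_left_commute scale_of_real)
  have f_add: "f (x + y) = f x + f y" for x y
    by (simp add: f_def scale_right_distrib linear_add[OF g(1)] algebra_simps)
  have f_real: "f (s (of_real r) x) = of_real r * f x" for r x
    by (simp add: f_def scale_of_real s_real linear_scale[OF g(1)] algebra_simps)
  have f_j: "f (s j x) = j * f x" for x
    using R(5)
  proof
    assume "j = 0"
    then show ?thesis by (simp add: f_def linear_0[OF g(1)])
  next
    assume jj: "j * j = -1"
    have "g (s j (s j x)) = - g x"
      using jj linear_neg[OF g(1)] by (simp add: scale_minus_left)
    then show ?thesis
      using jj by (simp add: f_def right_diff_distrib mult.assoc[symmetric])
  qed
  have f_scale: "f (s c x) = c * f x" for c x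
  proof -
    let ?a = "of_real (R c) :: 'k" and ?b = "of_real (- R (j * c)) :: 'k"
    have c: "c = ?a + j * ?b"
      using R(1)[of c] by simp
    have "f (s c x) = f (s ?a x + s j (s ?b x))"
      using c by (metis scale_left_distrib scale_scale)
    also have "\<dots> = ?a * f x + j * (?b * f x)"
      by (simp only: f_add f_j f_real)
    also have "\<dots> = c * f x"
      by (subst (3) c) (simp add: algebra_simps)
    finally show ?thesis .
  qed
  have R_f: "R (f x) = g x" for x
  proof -
    have "R (f x) = g x - R (j * of_real (g (s j x)))"
      by (simp add: f_def linear_diff[OF R(2)] R(4))
    moreover have "R (j * of_real r) = 0" for r
    proof -
      have "R (j * of_real r) = r * R j"
        using linear_scale[OF R(2), of r j] by (simp add: scaleR_conv_of_real mult.commute)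
      moreover have "R j = 0"
      proof -
        \<comment> \<open>When \<open>j * j = -1\<close>, the decomposition of \<open>j\<close>
          itself reads \<open>j = R j + j\<close>, which forces \<open>R j = 0\<close>.\<close>
        have "j = of_real (R j) - j * of_real (R (j * j))"
          by (rule R(1))
        moreover have "j = 0 \<or> R (j * j) = -1"
          using R(5) R(4)[of "-1"] by auto
        ultimately have "of_real (R j) = (0 :: 'k) \<or> j = 0"
          by auto
        then show ?thesis
          using linear_0[OF R(2)] by auto
      qed
      ultimately show ?thesis by simp
    qed
    ultimately show ?thesis by simp
  qed
  have f_le: "norm (f x) \<le> norm x" for x
  proof (cases "f x = 0")
    case False
    \<comment> \<open>This scalar has norm one and turns \<open>f x\<close> into its absolute
      value.\<close>
    define c where "c = of_real (norm (f x)) / f x"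
    have "norm (f x) = R (f (s c x))"
      using False by (simp add: f_scale c_def R(4))
    also have "\<dots> = g (s c x)"
      by (rule R_f)
    also have "\<dots> \<le> norm (s c x)"
      by (rule g(2))
    also have "\<dots> = norm x"
      using False by (simp add: norm_scale c_def norm_divide)
    finally show ?thesis .
  qed simp
  have "norm x0 \<le> norm (f x0)"
    using R(3)[of "f x0"] g(3) by (simp add: R_f)
  moreover have "f \<in> bounded_functionals s UNIV"
    unfolding bounded_functionals_def
    using f_add f_scale f_le by (auto intro!: exI[of _ 1])
  ultimately show ?thesis
    using f_le that by blast
qed
section \<open>Norming families of functionals\<close>

text \<open>A countable dense set is pulled back along the isometry to the reals or complexes. It
  later supplies the coefficients in countable sets of multiples.\<close>

lemma real_or_complex_separable:
  obtains K :: "'k::real_or_complex set" where "countable K" "closure K = UNIV"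
proof -
  have *: "\<exists>K :: 'k set. countable K \<and> closure K = UNIV"
    if h: "bij h" "\<forall>x y. h (x + y) = h x + h y" "\<forall>r x. h (r *\<^sub>R x) = r *\<^sub>R h x"
      "\<forall>x. norm (h x) = norm x"
    for h :: "'k \<Rightarrow> 'c::{real_normed_vector, second_countable_topology}"
  proof -
    obtain D :: "'c set" where D: "countable D" "\<And>X. open X \<Longrightarrow> X \<noteq> {} \<Longrightarrow> \<exists>d\<in>D. d \<in> X"
      using countable_dense_setE[where 'a = 'c] by metis
    have lin: "linear h" using h by (intro linearI) auto
    have dist_h: "dist (h x) (h y) = dist x y" for x y
      using h(4) by (simp add: dist_norm flip: linear_diff[OF lin])
    have "x \<in> closure (inv h ` D)" for x
      unfolding closure_approachable
    proof (intro allI impI)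
      fix e :: real assume "e > 0"
      then obtain d where "d \<in> D" "d \<in> ball (h x) e"
        using D(2)[of "ball (h x) e"] by auto
      moreover have "dist (inv h d) x = dist d (h x)"
        using dist_h[of "inv h d" x] surj_f_inv_f[OF bij_is_surj[OF h(1)], of d] by simp
      ultimately show "\<exists>y\<in>inv h ` D. dist y x < e"
        by (auto intro!: bexI[of _ d] simp: dist_commute)
    qed
    then show ?thesis
      using D(1) by (intro exI[of _ "inv h ` D"]) auto
  qed
  have "\<exists>K :: 'k set. countable K \<and> closure K = UNIV"
    using real_or_complex[where 'a = 'k]
  proof (elim disjE exE conjE)
    fix h :: "'k \<Rightarrow> real"
    assume "bij h" "\<forall>x y. h (x + y) = h x + h y" "\<forall>r x. h (r *\<^sub>R x) = r *\<^sub>R h x" "\<forall>x. norm (h x) = norm x"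
    then show ?thesis by (rule *)
  next
    fix h :: "'k \<Rightarrow> complex"
    assume "bij h" "\<forall>x y. h (x + y) = h x + h y" "\<forall>r x. h (r *\<^sub>R x) = r *\<^sub>R h x" "\<forall>x. norm (h x) = norm x"
    then show ?thesis by (rule *)
  qed
  then show thesis using that by blast
qed

text \<open>The two requirements work in opposite directions. Open sets being norm open makes coarse
  Borel sets norm Borel; closed balls being closed gives enough coarse Borel sets to recover the
  norm Borel sets on separable parts. Weak and weak-star topologies are treated at once in this
  form.\<close>

definition coarse_topology :: "'a::real_normed_vector set \<Rightarrow> 'a topology \<Rightarrow> bool" where
  "coarse_topology S \<tau> \<longleftrightarrow> topspace \<tau> = S \<and> (\<forall>U. openin \<tau> U \<longrightarrow> openin (norm_topology S) U) \<and>
     (\<forall>x\<in>S. \<forall>r\<ge>0. closedin \<tau> (S \<inter> cball x r))"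

lemma coarse_topology_topspace: "coarse_topology S \<tau> \<Longrightarrow> topspace \<tau> = S"
  by (simp add: coarse_topology_def)

lemma coarse_topology_openin: "coarse_topology S \<tau> \<Longrightarrow> openin \<tau> U \<Longrightarrow> openin (norm_topology S) U"
  by (simp add: coarse_topology_def)

lemma coarse_topology_cball:
  "coarse_topology S \<tau> \<Longrightarrow> x \<in> S \<Longrightarrow> r \<ge> 0 \<Longrightarrow> closedin \<tau> (S \<inter> cball x r)"
  by (simp add: coarse_topology_def)

text \<open>\<open>F_contractive\<close> and \<open>F_norming\<close> express the norm as a supremum
  over \<open>F\<close> that need not be attained: for functionals evaluated on the unit ball of the
  predual it may fail to be a maximum.\<close>

locale norming_subspace = normed_space_over s
  for s :: "'k::real_or_complex \<Rightarrow> 'a::real_normed_vector \<Rightarrow> 'a" +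
  fixes S :: "'a set" and F :: "('a \<Rightarrow> 'k) set"
  assumes zero_mem: "0 \<in> S"
    and add_mem: "x \<in> S \<Longrightarrow> y \<in> S \<Longrightarrow> x + y \<in> S"
    and scale_mem: "x \<in> S \<Longrightarrow> s c x \<in> S"
    and F_functionals: "F \<subseteq> bounded_functionals s S"
    and F_contractive: "f \<in> F \<Longrightarrow> x \<in> S \<Longrightarrow> norm (f x) \<le> norm x"
    and F_norming: "x \<in> S \<Longrightarrow> C \<ge> 0 \<Longrightarrow> (\<And>f. f \<in> F \<Longrightarrow> norm (f x) \<le> C) \<Longrightarrow> norm x \<le> C"
begin

lemma diff_mem: "x \<in> S \<Longrightarrow> y \<in> S \<Longrightarrow> x - y \<in> S"
  using add_mem[of x "s (-1) y"] scale_mem[of y "-1"] by (simp add: scale_minus_left)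

lemma functional_add:
  "f \<in> bounded_functionals s S \<Longrightarrow> x \<in> S \<Longrightarrow> y \<in> S \<Longrightarrow> f (x + y) = f x + f y"
  by (auto simp: bounded_functionals_def)

lemma functional_scale:
  "f \<in> bounded_functionals s S \<Longrightarrow> x \<in> S \<Longrightarrow> f (s c x) = c * f x"
  by (auto simp: bounded_functionals_def)

lemma functional_diff:
  assumes "f \<in> bounded_functionals s S" "x \<in> S" "y \<in> S"
  shows "f (x - y) = f x - f y"
  using functional_add[OF assms(1,2) scale_mem[OF assms(3)], of "-1"] functional_scale[OF assms(1,3), of "-1"]
  by (simp add: scale_minus_left)

lemma functional_continuous:
  assumes "f \<in> bounded_functionals s S"
  shows "continuous_on S f"
proof -
  obtain C where C: "\<And>x. x \<in> S \<Longrightarrow> norm (f x) \<le> C * norm x"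
    using assms unfolding bounded_functionals_def by blast
  have "\<bar>C\<bar>-lipschitz_on S f"
  proof (rule lipschitz_onI)
    fix x y assume xy: "x \<in> S" "y \<in> S"
    have "norm (f (x - y)) \<le> C * norm (x - y)"
      by (intro C diff_mem xy)
    also have "\<dots> \<le> \<bar>C\<bar> * norm (x - y)"
      by (intro mult_right_mono) auto
    finally show "dist (f x) (f y) \<le> \<bar>C\<bar> * dist x y"
      by (simp add: dist_norm functional_diff[OF assms xy])
  qed simp
  then show ?thesis
    by (rule lipschitz_on_continuous_on)
qed

lemma F_separating:
  assumes "x \<in> S" "x \<noteq> 0"
  obtains f where "f \<in> F" "f x \<noteq> 0"
  using F_norming[OF assms(1), of 0] assms(2) by force

text \<open>Members of \<open>G\<close> are norm continuous, which gives the comparison of open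
  sets. For balls, \<open>y\<close> lies outside \<open>cball x r\<close> iff
  \<open>norm (f y - f x) > r\<close> for some \<open>f \<in> F\<close>, and these conditions are
  open because \<open>F \<subseteq> G\<close>.\<close>

lemma coarse_initial_topology:
  assumes "F \<subseteq> G" "G \<subseteq> bounded_functionals s S" "G \<noteq> {}"
  shows "coarse_topology S (initial_topology S G)"
  unfolding coarse_topology_def
proof (intro conjI allI impI ballI)
  let ?B = "{S \<inter> f -` U | f U. f \<in> G \<and> open U}"
  have sub: "S \<inter> f -` U \<in> ?B" if "f \<in> G" "open U" for f U
    using that by blast
  \<comment> \<open>The underlying set of a generated topology is the union of the subbase, so
    \<open>S\<close> must be exhibited in it: it is the preimage of all scalars under any member of
    \<open>G\<close>.\<close>
  have "S \<in> ?B"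
  proof -
    obtain f where "f \<in> G" using assms(3) by blast
    then show ?thesis using sub[of f UNIV] by simp
  qed
  then show top: "topspace (initial_topology S G) = S"
    unfolding initial_topology_def topology_generated_by_topspace by blast
  show "openin (norm_topology S) U" if "openin (initial_topology S G) U" for U
  proof (rule generate_topology_on_coarsest)
    show "istopology (openin (norm_topology S))"
      by (rule istopology_openin)
    show "openin (norm_topology S) V" if "V \<in> ?B" for V
      using that functional_continuous assms(2) continuous_openin_preimage_gen
      unfolding norm_topology_def by blast
    show "generate_topology_on ?B U"
      using that by (simp add: initial_topology_def openin_topology_generated_by_iff)
  qed
  fix x and r :: real assume x: "x \<in> S" and r: "r \<ge> 0"
  have "S - S \<inter> cball x r = (\<Union>f\<in>F. S \<inter> f -` {c. r < norm (c - f x)})"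
  proof (intro equalityI subsetI)
    fix y assume y: "y \<in> S - S \<inter> cball x r"
    then have "\<not> norm (y - x) \<le> r"
      by (auto simp: dist_norm norm_minus_commute)
    then obtain f where f: "f \<in> F" "\<not> norm (f (y - x)) \<le> r"
      using F_norming[OF diff_mem r] y x by blast
    then show "y \<in> (\<Union>f\<in>F. S \<inter> f -` {c. r < norm (c - f x)})"
      using functional_diff[of f y x] F_functionals x y by fastforce
  next
    fix y assume "y \<in> (\<Union>f\<in>F. S \<inter> f -` {c. r < norm (c - f x)})"
    then obtain f where f: "f \<in> F" "y \<in> S" "r < norm (f y - f x)"
      by auto
    then have "r < norm (y - x)"
      using functional_diff[of f y x] F_functionals x F_contractive[OF f(1) diff_mem[OF f(2) x]] by fastforce
    then show "y \<in> S - S \<inter> cball x r"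
      using f(2) by (auto simp: dist_norm norm_minus_commute)
  qed
  moreover have "open {c :: 'k. r < norm (c - d)}" for d
    by (intro open_Collect_less continuous_intros)
  then have "openin (initial_topology S G) (\<Union>f\<in>F. S \<inter> f -` {c. r < norm (c - f x)})"
    unfolding initial_topology_def using assms(1)
    by (intro openin_Union) (auto simp del: vimage_Collect_eq intro!: topology_generated_by_Basis)
  ultimately have "openin (initial_topology S G) (S - S \<inter> cball x r)"
    by simp
  then show "closedin (initial_topology S G) (S \<inter> cball x r)"
    unfolding closedin_def top by auto
qed

end

text \<open>If \<open>scale a x\<close> is near \<open>scale c x'\<close>, then \<open>x\<close> is
  near \<open>scale (c / a) x'\<close>. The coefficient is then replaced by a nearby one from
  \<open>K\<close>, at a cost controlled by \<open>norm x' \<le> 1\<close>.\<close>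

lemma (in normed_space_over) mem_closure_multiples:
  assumes a: "a \<noteq> 0" and A: "A \<subseteq> cball 0 1" and K: "closure K = UNIV"
    and approx: "\<And>e. e > 0 \<Longrightarrow> \<exists>x'\<in>A. \<exists>c. norm (scale a x - scale c x') < e"
  shows "x \<in> closure ((\<lambda>(c, x'). scale c x') ` (K \<times> A))"
  unfolding closure_approachable
proof (intro allI impI)
  fix e :: real assume e: "e > 0"
  obtain x' c where x': "x' \<in> A" "norm (scale a x - scale c x') < norm a * (e / 2)"
    using approx[of "norm a * (e / 2)"] a e by auto
  have "scale a x - scale c x' = scale a (x - scale (c / a) x')"
    using a by (simp add: scale_right_diff_distrib)
  then have 1: "norm (x - scale (c / a) x') < e / 2"
    using x'(2) a by (simp add: norm_scale)
  obtain k where k: "k \<in> K" "dist k (c / a) < e / 2"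
    using K e closure_approachable[of "c / a" K] by (metis UNIV_I half_gt_zero)
  have "norm (scale (c / a) x' - scale k x') = norm (c / a - k) * norm x'"
    by (simp only: norm_scale scale_left_diff_distrib[symmetric])
  also have "\<dots> \<le> norm (c / a - k) * 1"
    using A x'(1) by (intro mult_left_mono) auto
  also have "\<dots> < e / 2"
    using k(2) by (simp add: dist_norm norm_minus_commute)
  finally have "norm (x - scale (c / a) x') + norm (scale (c / a) x' - scale k x') < e"
    using 1 by simp
  moreover have "norm (x - scale k x') \<le> norm (x - scale (c / a) x') + norm (scale (c / a) x' - scale k x')"
    using norm_triangle_ineq[of "x - scale (c / a) x'" "scale (c / a) x' - scale k x'"] by simp
  ultimately have "dist (scale k x') x < e"
    by (simp add: dist_norm norm_minus_commute)
  then show "\<exists>y\<in>(\<lambda>(c, x'). scale c x') ` (K \<times> A). dist y x < e"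
    using k(1) x'(1) by force
qed

text \<open>Points of \<open>V\<close> need not be values of \<open>f\<close>. For each
  \<open>v \<in> V\<close> and \<open>n\<close>, a point of \<open>D\<close> with value within
  \<open>1 / Suc n\<close> of \<open>v\<close> is chosen when one exists; the triangle inequality
  carries the approximation from \<open>V\<close> over to values of \<open>f\<close>.\<close>

lemma countable_approximating_preimages:
  fixes f :: "'a \<Rightarrow> 'z::metric_space"
  assumes "countable V"
  obtains P where "P \<subseteq> D" "countable P"
    "\<And>p e. p \<in> D \<Longrightarrow> f p \<in> closure V \<Longrightarrow> e > 0 \<Longrightarrow> \<exists>q\<in>P. dist (f p) (f q) < e"
proof -
  let ?I = "{(v, n :: nat). v \<in> V \<and> (\<exists>q\<in>D. dist (f q) v < 1 / Suc n)}"
  define g where "g i = (SOME q. q \<in> D \<and> dist (f q) (fst i) < 1 / Suc (snd i))" for i :: "'z \<times> nat"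
  have g: "g i \<in> D \<and> dist (f (g i)) (fst i) < 1 / Suc (snd i)" if "i \<in> ?I" for i
    unfolding g_def by (rule someI_ex) (use that in auto)
  have "countable ?I"
    by (rule countable_subset[of _ "V \<times> UNIV"]) (use assms in auto)
  moreover have "\<exists>q\<in>g ` ?I. dist (f p) (f q) < e" if p: "p \<in> D" "f p \<in> closure V" and e: "e > 0" for p e
  proof -
    obtain n :: nat where n: "1 / Suc n < e / 2"
      using e nat_approx_posE[of "e / 2"] by auto
    have "0 < 1 / real (Suc n)" by simp
    then obtain v where v: "v \<in> V" "dist v (f p) < 1 / Suc n"
      using p(2) unfolding closure_approachable by blast
    have i: "(v, n) \<in> ?I"
      using v p(1) by (auto simp: dist_commute intro!: bexI[of _ p])
    have "dist (f p) (f (g (v, n))) \<le> dist v (f p) + dist (f (g (v, n))) v"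
      by (metis dist_commute dist_triangle add.commute)
    also have "\<dots> < e"
      using g[OF i] v(2) n by simp
    finally show ?thesis using i by blast
  qed
  ultimately show thesis
    using g by (intro that[of "g ` ?I"]) (blast, simp, blast)
qed

section \<open>Elementary tensors\<close>

locale projective_tensor =
  X: norming_subspace sX S F + Y: norming_subspace sY T G
  for sX :: "'k::real_or_complex \<Rightarrow> 'a::real_normed_vector \<Rightarrow> 'a" and S F
    and sY :: "'k \<Rightarrow> 'b::real_normed_vector \<Rightarrow> 'b" and T G +
  fixes sZ :: "'k \<Rightarrow> 'z::banach \<Rightarrow> 'z" and t :: "'a \<Rightarrow> 'b \<Rightarrow> 'z"
  assumes tensor: "completed_projective_tensor_product sX S sY T sZ t"
begin

lemma t_bilinear: "bilinear_over sX S sY T sZ t"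
  using tensor by (simp add: completed_projective_tensor_product_def)

lemma norm_tensor_sum: "set xs \<subseteq> S \<times> T \<Longrightarrow> norm (tensor_sum t xs) = projective_norm sX S sY T xs"
  using tensor by (simp add: completed_projective_tensor_product_def)

lemma t_zero: "y \<in> T \<Longrightarrow> t 0 y = 0" "x \<in> S \<Longrightarrow> t x 0 = 0"
proof -
  show "t 0 y = 0" if "y \<in> T"
  proof -
    have "t (0 + 0) y = t 0 y + t 0 y"
      using t_bilinear X.zero_mem that unfolding bilinear_over_def by blast
    then show ?thesis by simp
  qed
  show "t x 0 = 0" if "x \<in> S"
  proof -
    have "t x (0 + 0) = t x 0 + t x 0"
      using t_bilinear Y.zero_mem that unfolding bilinear_over_def by blast
    then show ?thesis by simp
  qed
qed

lemma t_uminus: "x \<in> S \<Longrightarrow> y \<in> T \<Longrightarrow> t (- x) y = - t x y"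
proof -
  assume xy: "x \<in> S" "y \<in> T"
  then have "- x \<in> S"
    using X.diff_mem[OF X.zero_mem] by force
  then have "t (- x + x) y = t (- x) y + t x y"
    using t_bilinear xy unfolding bilinear_over_def by blast
  then show ?thesis
    using t_zero(1)[OF xy(2)] by (simp add: eq_neg_iff_add_eq_0)
qed

text \<open>The one-term list is itself among the representations over which the projective norm
  takes its infimum.\<close>

lemma norm_t_le:
  assumes "x \<in> S" "y \<in> T"
  shows "norm (t x y) \<le> norm x * norm y"
proof -
  let ?A = "{(\<Sum>(x, y)\<leftarrow>ys. norm x * norm y) | ys. set ys \<subseteq> S \<times> T \<and> same_tensor sX S sY T [(x, y)] ys}"
  have "norm (t x y) = Inf ?A"
    using norm_tensor_sum[of "[(x, y)]"] assms by (simp add: tensor_sum_def projective_norm_def)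
  also have "\<dots> \<le> norm x * norm y"
  proof (rule cInf_lower)
    show "norm x * norm y \<in> ?A"
      using assms by (auto simp: same_tensor_def intro!: exI[of _ "[(x, y)]"])
    show "bdd_below ?A"
      by (rule bdd_belowI[of _ 0]) (auto intro!: sum_list_nonneg)
  qed
  finally show ?thesis .
qed

text \<open>The product of \<open>f\<close> and \<open>g\<close> is a bilinear form, so it has the
  same value on every representation of the tensor, and each representation bounds this value by its
  sum of products of norms. The infimum of these bounds is the projective norm.\<close>

lemma functional_tensor_le:
  assumes f: "f \<in> F" and g: "g \<in> G" and xs: "set xs \<subseteq> S \<times> T"
  shows "norm (tensor_sum (\<lambda>x y. f x * g y) xs) \<le> norm (tensor_sum t xs)"
proof -
  let ?b = "\<lambda>x y. f x * g y"
  let ?A = "{(\<Sum>(x, y)\<leftarrow>ys. norm x * norm y) | ys. set ys \<subseteq> S \<times> T \<and> same_tensor sX S sY T xs ys}"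
  have f': "f \<in> bounded_functionals sX S" and g': "g \<in> bounded_functionals sY T"
    using f g X.F_functionals Y.F_functionals by auto
  have b: "bilinear_over sX S sY T (*) ?b"
    by (simp add: bilinear_over_def X.functional_add[OF f'] X.functional_scale[OF f']
        Y.functional_add[OF g'] Y.functional_scale[OF g'] algebra_simps)
  have bound: "norm (tensor_sum ?b ys) \<le> (\<Sum>(x, y)\<leftarrow>ys. norm x * norm y)" if "set ys \<subseteq> S \<times> T" for ys
    using that
  proof (induction ys)
    case Nil
    then show ?case by (simp add: tensor_sum_def)
  next
    case (Cons p ys)
    obtain x y where p: "p = (x, y)" by (cases p)
    have "norm (tensor_sum ?b (p # ys)) \<le> norm (f x * g y) + norm (tensor_sum ?b ys)"
      using norm_triangle_ineq by (simp add: tensor_sum_def p)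
    also have "norm (f x * g y) \<le> norm x * norm y"
      using Cons.prems X.F_contractive[OF f, of x] Y.F_contractive[OF g, of y]
      by (auto simp: p norm_mult intro!: mult_mono)
    finally show ?case
      using Cons by (simp add: p)
  qed
  have "norm (tensor_sum ?b xs) \<le> Inf ?A"
  proof (rule cInf_greatest)
    show "?A \<noteq> {}"
      using xs by (auto simp: same_tensor_def intro!: exI[of _ xs])
    fix r assume "r \<in> ?A"
    then obtain ys where ys: "r = (\<Sum>(x, y)\<leftarrow>ys. norm x * norm y)" "set ys \<subseteq> S \<times> T"
        "same_tensor sX S sY T xs ys"
      by blast
    have "tensor_sum ?b xs = tensor_sum ?b ys"
      using ys(3) b unfolding same_tensor_def by blast
    then show "norm (tensor_sum ?b xs) \<le> r"
      using bound[OF ys(2)] ys(1) by simp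
  qed
  then show ?thesis
    by (simp add: norm_tensor_sum[OF xs] projective_norm_def)
qed

lemma functional_tensor_diff_le:
  assumes f: "f \<in> F" and g: "g \<in> G" and mem: "x \<in> S" "x' \<in> S" "y \<in> T" "y' \<in> T"
  shows "norm (f x * g y - f x' * g y') \<le> norm (t x y - t x' y')"
proof -
  have x': "- x' \<in> S"
    using X.diff_mem[OF X.zero_mem mem(2)] by simp
  have "f (- x') = - f x'"
    using X.functional_diff[of f 0 x'] X.functional_diff[of f 0 0] f X.F_functionals mem X.zero_mem by auto
  then show ?thesis
    \<comment> \<open>The two-term list represents the difference of the elementary tensors, the
      minus sign being moved into a first factor.\<close>
    using functional_tensor_le[OF f g, of "[(x, y), (- x', y')]"] mem x'
    by (simp add: tensor_sum_def t_uminus)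
qed

text \<open>Testing the slice against the norming family \<open>F\<close> reduces the bound to the
  one for products of functionals.\<close>

lemma slice_left_le:
  assumes g: "g \<in> G" and mem: "x \<in> S" "x' \<in> S" "y \<in> T" "y' \<in> T"
  shows "norm (sX (g y) x - sX (g y') x') \<le> norm (t x y - t x' y')"
proof (rule X.F_norming)
  fix f assume f: "f \<in> F"
  then have f': "f \<in> bounded_functionals sX S" using X.F_functionals by auto
  show "norm (f (sX (g y) x - sX (g y') x')) \<le> norm (t x y - t x' y')"
    using functional_tensor_diff_le[OF f g mem] mem
    by (simp add: X.functional_diff[OF f'] X.functional_scale[OF f'] X.scale_mem mult.commute)
qed (use mem in \<open>auto intro: X.diff_mem X.scale_mem\<close>)

lemma slice_right_le:
  assumes f: "f \<in> F" and mem: "x \<in> S" "x' \<in> S" "y \<in> T" "y' \<in> T"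
  shows "norm (sY (f x) y - sY (f x') y') \<le> norm (t x y - t x' y')"
proof (rule Y.F_norming)
  fix g assume g: "g \<in> G"
  then have g': "g \<in> bounded_functionals sY T" using Y.F_functionals by auto
  show "norm (g (sY (f x) y - sY (f x') y')) \<le> norm (t x y - t x' y')"
    using functional_tensor_diff_le[OF f g mem] mem
    by (simp add: Y.functional_diff[OF g'] Y.functional_scale[OF g'] Y.scale_mem)
qed (use mem in \<open>auto intro: Y.diff_mem Y.scale_mem\<close>)

text \<open>An elementary tensor determines its factors up to scalars, so slicing it with functionals
  recovers separability of the factors from separability of the tensors.\<close>

lemma separable_factors:
  assumes V: "countable V"
  obtains CX CY where "countable CX" "countable CY" "CX \<subseteq> S" "CY \<subseteq> T"
    "\<And>x y. x \<in> S \<inter> cball 0 1 \<Longrightarrow> y \<in> T \<inter> cball 0 1 \<Longrightarrow> x \<noteq> 0 \<Longrightarrow> y \<noteq> 0 \<Longrightarrow>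
      t x y \<in> closure V \<Longrightarrow> x \<in> closure CX \<and> y \<in> closure CY"
proof -
  let ?D = "(S \<inter> cball 0 1) \<times> (T \<inter> cball 0 1)"
  obtain P where P: "P \<subseteq> ?D" "countable P"
      "\<And>p e. p \<in> ?D \<Longrightarrow> (\<lambda>(x, y). t x y) p \<in> closure V \<Longrightarrow> e > 0 \<Longrightarrow>
        \<exists>q\<in>P. dist ((\<lambda>(x, y). t x y) p) ((\<lambda>(x, y). t x y) q) < e"
    using countable_approximating_preimages[OF V, of ?D "\<lambda>(x, y). t x y"] by metis
  obtain K :: "'k set" where K: "countable K" "closure K = UNIV"
    by (rule real_or_complex_separable)
  show thesis
  proof (rule that[of "(\<lambda>(c, x'). sX c x') ` (K \<times> fst ` P)" "(\<lambda>(c, y'). sY c y') ` (K \<times> snd ` P)"])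
    show "(\<lambda>(c, x'). sX c x') ` (K \<times> fst ` P) \<subseteq> S" "(\<lambda>(c, y'). sY c y') ` (K \<times> snd ` P) \<subseteq> T"
      using P(1) by (auto intro!: X.scale_mem Y.scale_mem)
    fix x y assume x: "x \<in> S \<inter> cball 0 1" "x \<noteq> 0" and y: "y \<in> T \<inter> cball 0 1" "y \<noteq> 0"
      and V: "t x y \<in> closure V"
    have approx: "\<exists>q\<in>P. fst q \<in> S \<and> snd q \<in> T \<and> norm (t x y - t (fst q) (snd q)) < e" if "e > 0" for e
    proof -
      have "\<exists>q\<in>P. norm (t x y - t (fst q) (snd q)) < e"
        using P(3)[of "(x, y)" e] x y V that by (simp add: dist_norm split_beta)
      moreover have "fst q \<in> S \<and> snd q \<in> T" if "q \<in> P" for q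
        using P(1) that by auto
      ultimately show ?thesis by blast
    qed
    \<comment> \<open>Here both factors must be nonzero: \<open>x\<close> is recovered after
      division by \<open>g y\<close>, and \<open>y\<close> after division by
      \<open>f x\<close>.\<close>
    obtain f where f: "f \<in> F" "f x \<noteq> 0" using X.F_separating x by blast
    obtain g where g: "g \<in> G" "g y \<noteq> 0" using Y.F_separating y by blast
    show "x \<in> closure ((\<lambda>(c, x'). sX c x') ` (K \<times> fst ` P)) \<and> y \<in> closure ((\<lambda>(c, y'). sY c y') ` (K \<times> snd ` P))"
    proof (intro conjI X.mem_closure_multiples Y.mem_closure_multiples K(2))
      show "g y \<noteq> 0" "f x \<noteq> 0" by fact+
      show "fst ` P \<subseteq> cball 0 1" "snd ` P \<subseteq> cball 0 1" using P(1) by auto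
      fix e :: real assume "e > 0"
      then obtain q where q: "q \<in> P" "fst q \<in> S" "snd q \<in> T" "norm (t x y - t (fst q) (snd q)) < e"
        using approx by blast
      show "\<exists>x'\<in>fst ` P. \<exists>c. norm (sX (g y) x - sX c x') < e"
        using slice_left_le[OF g(1) _ q(2) _ q(3), of x y] q x y
        by (intro bexI[of _ "fst q"] exI[of _ "g (snd q)"]) auto
      show "\<exists>y'\<in>snd ` P. \<exists>c. norm (sY (f x) y - sY c y') < e"
        using slice_right_le[OF f(1) _ q(2) _ q(3), of x y] q x y
        by (intro bexI[of _ "snd q"] exI[of _ "f (fst q)"]) auto
    qed
  qed (use K P in auto)
qed

end

section \<open>Comparison of the topologies\<close>

lemma norm_topology_ball_product:
  "ball_product (norm_topology S) (norm_topology T) = top_of_set ((S \<inter> cball 0 1) \<times> (T \<inter> cball 0 1))"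
  by (simp add: ball_product_def norm_topology_def subtopology_subtopology prod_topology_subtopology_eu)

lemma openin_ball_product_box:
  fixes S :: "'a::real_normed_vector set" and T :: "'b::real_normed_vector set"
  assumes "openin (ball_product (norm_topology S) (norm_topology T)) U" "(x, y) \<in> U"
  obtains e where "e > 0" "((S \<inter> cball 0 1) \<times> (T \<inter> cball 0 1)) \<inter> (cball x e \<times> cball y e) \<subseteq> U"
proof -
  obtain O' where O': "open O'" "U = ((S \<inter> cball 0 1) \<times> (T \<inter> cball 0 1)) \<inter> O'"
    using assms(1) unfolding norm_topology_ball_product openin_open by blast
  then obtain A B where AB: "open A" "open B" "(x, y) \<in> A \<times> B" "A \<times> B \<subseteq> O'"
    using assms(2) by (metis IntD2 open_prod_def)
  obtain a b where ab: "a > 0" "cball x a \<subseteq> A" "b > 0" "cball y b \<subseteq> B"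
    using AB by (metis mem_Sigma_iff open_contains_cball)
  have "cball x (min a b) \<subseteq> cball x a" "cball y (min a b) \<subseteq> cball y b"
    by auto
  then show thesis
    using ab AB(4) O'(2) by (intro that[of "min a b"]) (simp, blast)
qed

locale coarse_projective_tensor = projective_tensor sX S F sY T G sZ t
  for sX :: "'k::real_or_complex \<Rightarrow> 'a::real_normed_vector \<Rightarrow> 'a" and S F
    and sY :: "'k \<Rightarrow> 'b::real_normed_vector \<Rightarrow> 'b" and T G
    and sZ :: "'k \<Rightarrow> 'z::banach \<Rightarrow> 'z" and t +
  fixes \<tau>X :: "'a topology" and \<tau>Y :: "'b topology"
  assumes \<tau>X: "coarse_topology S \<tau>X" and \<tau>Y: "coarse_topology T \<tau>Y"
begin

definition D :: "('a \<times> 'b) set" where "D = (S \<inter> cball 0 1) \<times> (T \<inter> cball 0 1)"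

definition \<tau> :: "('a \<times> 'b) topology" where "\<tau> = ball_product \<tau>X \<tau>Y"

definition \<nu> :: "('a \<times> 'b) topology" where "\<nu> = ball_product (norm_topology S) (norm_topology T)"

text \<open>Only the sigma-algebra of this measure matters; packed as a measure it can be the target
  of \<open>distr\<close>.\<close>

definition Borel\<^sub>\<tau> :: "('a \<times> 'b) measure" where "Borel\<^sub>\<tau> = sigma D {U. openin \<tau> U}"

definition Borel\<^sub>\<nu> :: "('a \<times> 'b) measure" where "Borel\<^sub>\<nu> = sigma D {U. openin \<nu> U}"

lemma topspace_\<tau>: "topspace \<tau> = D"
  by (simp add: \<tau>_def D_def ball_product_def coarse_topology_topspace[OF \<tau>X] coarse_topology_topspace[OF \<tau>Y])

lemma topspace_\<nu>: "topspace \<nu> = D"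
  by (simp add: \<nu>_def D_def norm_topology_ball_product)

lemma openin_\<nu>: "openin \<tau> U \<Longrightarrow> openin \<nu> U"
proof -
  have *: "openin (subtopology (norm_topology S') (cball 0 1)) V"
    if "coarse_topology S' \<sigma>" "openin (subtopology \<sigma> (cball 0 1)) V"
    for S' :: "'c::real_normed_vector set" and \<sigma> V
    using that coarse_topology_openin by (auto simp: openin_subtopology)
  assume "openin \<tau> U"
  then show "openin \<nu> U"
    unfolding \<tau>_def \<nu>_def ball_product_def openin_prod_topology_alt
    using *[OF \<tau>X] *[OF \<tau>Y] by meson
qed

lemma sets_Borel\<^sub>\<tau>: "sets Borel\<^sub>\<tau> = sigma_sets D {U. openin \<tau> U}"
  unfolding Borel\<^sub>\<tau>_def by (rule sets_measure_of) (use openin_subset topspace_\<tau> in auto)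

lemma sets_Borel\<^sub>\<nu>: "sets Borel\<^sub>\<nu> = sigma_sets D {U. openin \<nu> U}"
  unfolding Borel\<^sub>\<nu>_def by (rule sets_measure_of) (use openin_subset topspace_\<nu> in auto)

lemma space_Borel\<^sub>\<tau> [simp]: "space Borel\<^sub>\<tau> = D"
  by (simp add: Borel\<^sub>\<tau>_def space_measure_of_conv)

lemma space_Borel\<^sub>\<nu> [simp]: "space Borel\<^sub>\<nu> = D"
  by (simp add: Borel\<^sub>\<nu>_def space_measure_of_conv)

lemma Borel\<^sub>\<tau>_subset_Borel\<^sub>\<nu>: "sets Borel\<^sub>\<tau> \<subseteq> sets Borel\<^sub>\<nu>"
  unfolding sets_Borel\<^sub>\<tau> sets_Borel\<^sub>\<nu> using openin_\<nu> by (intro sigma_sets_mono') auto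

lemma is_borel_measure_\<tau>: "is_borel_measure \<tau> \<mu> \<longleftrightarrow> sets \<mu> = sets Borel\<^sub>\<tau>"
  unfolding is_borel_measure_def topspace_\<tau> sets_Borel\<^sub>\<tau>[symmetric]
  using sets_eq_imp_space_eq[of \<mu> Borel\<^sub>\<tau>] by auto

lemma is_borel_measure_\<nu>: "is_borel_measure \<nu> \<mu> \<longleftrightarrow> sets \<mu> = sets Borel\<^sub>\<nu>"
  unfolding is_borel_measure_def topspace_\<nu> sets_Borel\<^sub>\<nu>[symmetric]
  using sets_eq_imp_space_eq[of \<mu> Borel\<^sub>\<nu>] by auto

section \<open>Norm-separable Borel sets of the coarse topology\<close>

lemma closed_box_sets:
  assumes "x \<in> S" "y \<in> T" "r \<ge> 0" "r' \<ge> 0"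
  shows "D \<inter> (cball x r \<times> cball y r') \<in> sets Borel\<^sub>\<tau>"
proof -
  have "closedin (subtopology \<tau>X (cball 0 1)) ((S \<inter> cball x r) \<inter> cball 0 1)"
    "closedin (subtopology \<tau>Y (cball 0 1)) ((T \<inter> cball y r') \<inter> cball 0 1)"
    using coarse_topology_cball[OF \<tau>X assms(1,3)] coarse_topology_cball[OF \<tau>Y assms(2,4)]
    by (auto simp: closedin_subtopology)
  then have "closedin \<tau> (((S \<inter> cball x r) \<inter> cball 0 1) \<times> ((T \<inter> cball y r') \<inter> cball 0 1))"
    unfolding \<tau>_def ball_product_def closedin_prod_Times_iff by blast
  moreover have "((S \<inter> cball x r) \<inter> cball 0 1) \<times> ((T \<inter> cball y r') \<inter> cball 0 1) = D \<inter> (cball x r \<times> cball y r')"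
    by (auto simp: D_def)
  ultimately have c: "closedin \<tau> (D \<inter> (cball x r \<times> cball y r'))"
    by simp
  then have "D - D \<inter> (cball x r \<times> cball y r') \<in> sets Borel\<^sub>\<tau>"
    unfolding sets_Borel\<^sub>\<tau> closedin_def topspace_\<tau> by (intro sigma_sets.Basic) simp
  then have "space Borel\<^sub>\<tau> - (D - D \<inter> (cball x r \<times> cball y r')) \<in> sets Borel\<^sub>\<tau>"
    by (rule sets.compl_sets)
  moreover have "space Borel\<^sub>\<tau> - (D - D \<inter> (cball x r \<times> cball y r')) = D \<inter> (cball x r \<times> cball y r')"
    by auto
  ultimately show ?thesis by simp
qed

text \<open>Zero is the only point of the closed ball of radius zero around it, so the set is a
  union of two closed boxes. On it the elementary tensors vanish.\<close>

lemma vanishing_set_sets: "{p \<in> D. fst p = 0 \<or> snd p = 0} \<in> sets Borel\<^sub>\<tau>"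
proof -
  have "{p \<in> D. fst p = 0 \<or> snd p = 0} =
      D \<inter> (cball 0 0 \<times> cball 0 1) \<union> D \<inter> (cball 0 1 \<times> cball 0 0)"
    by (auto simp: D_def)
  moreover have "D \<inter> (cball 0 0 \<times> cball 0 1) \<union> D \<inter> (cball 0 1 \<times> cball 0 0) \<in> sets Borel\<^sub>\<tau>"
    by (intro sets.Un closed_box_sets X.zero_mem Y.zero_mem) auto
  ultimately show ?thesis by simp
qed

definition separable_part :: "'a set \<Rightarrow> 'b set \<Rightarrow> ('a \<times> 'b) set" where
  "separable_part CX CY = {p \<in> D. fst p \<in> closure CX \<and> snd p \<in> closure CY}"

lemma separable_part_approx:
  assumes "(x, y) \<in> separable_part CX CY" "e > 0"
  obtains a b where "a \<in> CX" "b \<in> CY" "dist a x < e" "dist b y < e"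
  using assms unfolding separable_part_def closure_approachable by fastforce

text \<open>A norm closed set need not be closed in the coarse topology, but the closure of a
  countable set arises from closed balls by countable unions and intersections.\<close>

lemma separable_part_sets:
  assumes C: "countable CX" "countable CY" "CX \<subseteq> S" "CY \<subseteq> T"
  shows "separable_part CX CY \<in> sets Borel\<^sub>\<tau>"
proof -
  let ?r = "\<lambda>n::nat. 1 / real (Suc n)"
  have "separable_part CX CY = (\<Inter>n. \<Union>a\<in>CX. \<Union>b\<in>CY. D \<inter> (cball a (?r n) \<times> cball b (?r n)))" (is "_ = ?R")
  proof (intro equalityI subsetI INT_I)
    fix p n assume p: "p \<in> separable_part CX CY"
    obtain x y where xy: "p = (x, y)" by (cases p)
    have "?r n > 0" by simp
    then obtain a b where "a \<in> CX" "b \<in> CY" "dist a x < ?r n" "dist b y < ?r n"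
      using separable_part_approx[OF p[unfolded xy]] by blast
    moreover have "p \<in> D" using p by (simp add: separable_part_def)
    ultimately show "p \<in> (\<Union>a\<in>CX. \<Union>b\<in>CY. D \<inter> (cball a (?r n) \<times> cball b (?r n)))"
      unfolding xy by (intro UN_I) (auto intro: less_imp_le)
  next
    fix p assume p: "p \<in> ?R"
    have "\<exists>a\<in>CX. \<exists>b\<in>CY. p \<in> D \<and> dist a (fst p) < e \<and> dist b (snd p) < e" if e: "e > 0" for e
    proof -
      obtain n where n: "?r n < e"
        using nat_approx_posE[OF e] by blast
      have "p \<in> (\<Union>a\<in>CX. \<Union>b\<in>CY. D \<inter> (cball a (?r n) \<times> cball b (?r n)))"
        using p by blast
      then obtain a b where "a \<in> CX" "b \<in> CY" "p \<in> D" "dist a (fst p) \<le> ?r n" "dist b (snd p) \<le> ?r n"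
        by auto
      then show ?thesis using n by (meson le_less_trans)
    qed
    note approx = this
    have "p \<in> D" using approx[of 1] by auto
    then show "p \<in> separable_part CX CY"
      unfolding separable_part_def closure_approachable using approx by blast
  qed
  moreover have "(\<Union>a\<in>CX. \<Union>b\<in>CY. D \<inter> (cball a (?r n) \<times> cball b (?r n))) \<in> sets Borel\<^sub>\<tau>" for n
    using C(3,4) by (intro sets.countable_UN'' C(1,2) closed_box_sets) auto
  then have "?R \<in> sets Borel\<^sub>\<tau>"
    by blast
  ultimately show ?thesis by simp
qed

text \<open>The norm topology of the separable part has a base of closed balls with centers in a
  countable set.\<close>

lemma Borel\<^sub>\<nu>_trace:
  assumes C: "countable CX" "countable CY" "CX \<subseteq> S" "CY \<subseteq> T" and B: "B \<in> sets Borel\<^sub>\<nu>"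
  shows "B \<inter> separable_part CX CY \<in> sets Borel\<^sub>\<tau>"
  using B unfolding sets_Borel\<^sub>\<nu>
proof (induction B rule: sigma_sets.induct)
  case Empty
  show ?case by simp
next
  case (Compl B)
  have "(D - B) \<inter> separable_part CX CY = separable_part CX CY - B \<inter> separable_part CX CY"
    by (auto simp: separable_part_def)
  then show ?case
    using Compl.IH separable_part_sets[OF C] by auto
next
  case (Union B)
  have "(\<Union>i. B i) \<inter> separable_part CX CY = (\<Union>i. B i \<inter> separable_part CX CY)"
    by auto
  moreover have "(\<Union>i. B i \<inter> separable_part CX CY) \<in> sets Borel\<^sub>\<tau>"
    using Union.IH by blast
  ultimately show ?case by simp
next
  case (Basic U)
  then have U: "openin \<nu> U" by simp
  let ?r = "\<lambda>n::nat. 1 / real (Suc n)"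
  let ?box = "\<lambda>(a, b, n). D \<inter> (cball a (?r n) \<times> cball b (?r n))"
  let ?I = "{i \<in> CX \<times> CY \<times> UNIV. ?box i \<subseteq> U}"
  have "U \<inter> separable_part CX CY \<subseteq> (\<Union>i\<in>?I. ?box i)"
  proof
    fix p assume p: "p \<in> U \<inter> separable_part CX CY"
    obtain x y where xy: "p = (x, y)" by (cases p)
    obtain e where e: "e > 0" "D \<inter> (cball x e \<times> cball y e) \<subseteq> U"
      using openin_ball_product_box[OF U[unfolded \<nu>_def]] p xy unfolding D_def by blast
    \<comment> \<open>The centers found below are within \<open>?r n\<close> of the point, so balls
      of that same radius around them stay within distance \<open>2 * ?r n < e\<close> of
      it.\<close>
    obtain n where n: "?r n < e / 2"
      using nat_approx_posE[of "e / 2"] e(1) by auto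
    have "?r n > 0" by simp
    then obtain a b where ab: "a \<in> CX" "b \<in> CY" "dist a x < ?r n" "dist b y < ?r n"
      using separable_part_approx[of x y] p xy by blast
    have "cball c (?r n) \<subseteq> cball z e" if "dist c z < ?r n" for c z :: "'c::metric_space"
    proof
      fix w assume "w \<in> cball c (?r n)"
      then show "w \<in> cball z e"
        using that n dist_triangle[of z w c] by (simp add: dist_commute)
    qed
    then have "cball a (?r n) \<subseteq> cball x e" "cball b (?r n) \<subseteq> cball y e"
      using ab(3,4) by blast+
    then have "?box (a, b, n) \<subseteq> U"
      using e(2) by auto
    then have "(a, b, n) \<in> ?I"
      using ab by simp
    moreover have "p \<in> ?box (a, b, n)"
      using p ab(3,4) xy by (auto simp: separable_part_def)
    ultimately show "p \<in> (\<Union>i\<in>?I. ?box i)"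
      by blast
  qed
  then have "U \<inter> separable_part CX CY = separable_part CX CY \<inter> (\<Union>i\<in>?I. ?box i)"
    by blast
  moreover have "countable ?I"
    by (rule countable_subset[of _ "CX \<times> CY \<times> UNIV"]) (use C(1,2) in auto)
  moreover have "?box i \<in> sets Borel\<^sub>\<tau>" if "i \<in> ?I" for i
    using that C(3,4) by (auto intro!: closed_box_sets simp del: Times_Int_Times)
  ultimately show ?case
    using sets.Int[OF separable_part_sets[OF C] sets.countable_UN''[of ?I ?box]] by simp
qed

section \<open>Independence of the topology\<close>

text \<open>Two null sets are discarded: the zeros of the integrand, by norm attainment, and the
  points whose tensor is not a limit of values of the simple functions. Asking for an inclusion of
  sigma-algebras lets the result apply to measures for either topology.\<close>

lemma AE_separable_part:
  assumes \<mu>: "space \<mu> = D" "sets Borel\<^sub>\<tau> \<subseteq> sets \<mu>" "finite_measure \<mu>"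
    and int: "bochner_integrable_on \<mu> (\<lambda>(x, y). t x y)"
    and val: "has_bochner_value \<mu> (\<lambda>(x, y). t x y) u" "measure \<mu> (space \<mu>) = norm u"
  obtains CX CY where "countable CX" "countable CY" "CX \<subseteq> S" "CY \<subseteq> T"
    "AE p in \<mu>. p \<in> separable_part CX CY"
proof -
  let ?\<phi> = "\<lambda>(x, y). t x y"
  let ?E = "{p \<in> D. fst p = 0 \<or> snd p = 0}"
  have nonzero: "AE p in \<mu>. p \<notin> ?E"
  proof (rule has_bochner_value_AE_nonzero[OF \<mu>(3) val(1) _ _ _ val(2)])
    show "?E \<in> sets \<mu>" using \<mu>(2) vanishing_set_sets by blast
    show "?\<phi> p = 0" if "p \<in> ?E" for p
      using that t_zero by (auto simp: D_def)
    show "norm (?\<phi> p) \<le> 1" if p: "p \<in> space \<mu>" for p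
    proof -
      obtain x y where xy: "p = (x, y)" "x \<in> S" "y \<in> T" "norm x \<le> 1" "norm y \<le> 1"
        using p by (auto simp: \<mu>(1) D_def)
      have "norm (t x y) \<le> norm x * norm y"
        by (rule norm_t_le) fact+
      also have "\<dots> \<le> 1"
        using xy by (simp add: mult_le_one)
      finally show ?thesis by (simp add: xy(1))
    qed
  qed
  obtain s where s: "\<And>i::nat. simple_function \<mu> (s i)" "AE p in \<mu>. (\<lambda>i. s i p) \<longlonglongrightarrow> ?\<phi> p"
    using int unfolding bochner_integrable_on_def by blast
  let ?V = "\<Union>i. s i ` space \<mu>"
  have V: "countable ?V"
    by (intro countable_UN countable_finite[OF simple_functionD(1)[OF s(1)]]) auto
  obtain CX CY where C: "countable CX" "countable CY" "CX \<subseteq> S" "CY \<subseteq> T"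
      "\<And>x y. x \<in> S \<inter> cball 0 1 \<Longrightarrow> y \<in> T \<inter> cball 0 1 \<Longrightarrow> x \<noteq> 0 \<Longrightarrow> y \<noteq> 0 \<Longrightarrow>
        t x y \<in> closure ?V \<Longrightarrow> x \<in> closure CX \<and> y \<in> closure CY"
    using separable_factors[OF V] by metis
  have "AE p in \<mu>. p \<in> separable_part CX CY"
    using nonzero s(2) AE_space
  proof eventually_elim
    case (elim p)
    obtain x y where xy: "p = (x, y)" "x \<in> S \<inter> cball 0 1" "y \<in> T \<inter> cball 0 1"
      using elim(3) by (auto simp: \<mu>(1) D_def)
    have "?\<phi> p \<in> closure ?V"
      using elim(2,3) unfolding closure_sequential by (intro exI[of _ "\<lambda>i. s i p"]) auto
    then have "x \<in> closure CX \<and> y \<in> closure CY"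
      using elim(1,3) xy by (intro C(5)) (auto simp: \<mu>(1))
    then show ?case
      using elim(3) by (simp add: xy(1) \<mu>(1) separable_part_def)
  qed
  then show thesis
    by (rule that[OF C(1-4)])
qed

text \<open>From norm to coarse the measure is restricted. Conversely it is extended to a larger
  sigma-algebra, which is possible because it is concentrated on a separable part. In each case the
  two measures form a \<open>conull_trace\<close>.\<close>

theorem INA_coarse_eq_INA_norm: "INA (ball_product \<tau>X \<tau>Y) t = INA_norm S T t"
proof -
  let ?\<phi> = "\<lambda>(x, y). t x y"
  have "INA \<tau> t = INA \<nu> t"
  proof (intro equalityI subsetI)
    fix u assume "u \<in> INA \<tau> t"
    then obtain \<mu> where \<mu>: "sets \<mu> = sets Borel\<^sub>\<tau>" "finite_measure \<mu>" "bochner_integrable_on \<mu> ?\<phi>"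
        "has_bochner_value \<mu> ?\<phi> u" "measure \<mu> (space \<mu>) = norm u"
      unfolding INA_def is_borel_measure_\<tau> by blast
    have sp: "space \<mu> = D"
      using sets_eq_imp_space_eq[OF \<mu>(1)] by simp
    obtain CX CY where C: "countable CX" "countable CY" "CX \<subseteq> S" "CY \<subseteq> T"
        "AE p in \<mu>. p \<in> separable_part CX CY"
      using AE_separable_part[OF sp _ \<mu>(2-5)] \<mu>(1) by blast
    let ?A = "separable_part CX CY"
    have A: "?A \<in> sets \<mu>"
      using separable_part_sets[OF C(1-4)] \<mu>(1) by simp
    have sub: "?A \<subseteq> D"
      by (auto simp: separable_part_def)
    \<comment> \<open>The extension is an image measure: the map is the identity on
      \<open>?A\<close>, where norm Borel sets have coarse Borel traces, and it collapses the null
      complement to the point \<open>(0, 0)\<close> of \<open>D\<close>.\<close>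
    let ?\<psi> = "\<lambda>p. if p \<in> ?A then p else (0, 0)"
    have \<psi>: "?\<psi> \<in> measurable \<mu> Borel\<^sub>\<nu>"
    proof (rule measurableI)
      show "?\<psi> p \<in> space Borel\<^sub>\<nu>" for p
        using sub X.zero_mem Y.zero_mem by (auto simp: D_def)
      fix B assume "B \<in> sets Borel\<^sub>\<nu>"
      then have "B \<inter> ?A \<in> sets \<mu>"
        using Borel\<^sub>\<nu>_trace[OF C(1-4)] \<mu>(1) by simp
      moreover have "?\<psi> -` B \<inter> space \<mu> = (B \<inter> ?A) \<union> (if (0, 0) \<in> B then space \<mu> - ?A else {})"
        using sub by (auto simp: sp split: if_splits)
      ultimately show "?\<psi> -` B \<inter> space \<mu> \<in> sets \<mu>"
        using A by auto
    qed
    let ?N = "distr \<mu> Borel\<^sub>\<nu> ?\<psi>"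
    have ct: "conull_trace \<mu> ?N ?A"
    proof
      show "space ?N = space \<mu>" by (simp add: sp)
      show "sets \<mu> \<subseteq> sets ?N" using Borel\<^sub>\<tau>_subset_Borel\<^sub>\<nu> \<mu>(1) by simp
      show "?A \<in> sets \<mu>" by (rule A)
      show "emeasure \<mu> (space \<mu> - ?A) = 0"
        by (rule emeasure_compl_eq_0[OF C(5) A])
      show "B \<inter> ?A \<in> sets \<mu>" if "B \<in> sets ?N" for B
        using that Borel\<^sub>\<nu>_trace[OF C(1-4)] \<mu>(1) by simp
      fix B assume B: "B \<in> sets \<mu>"
      then have B': "B \<in> sets Borel\<^sub>\<nu>"
        using Borel\<^sub>\<tau>_subset_Borel\<^sub>\<nu> \<mu>(1) by auto
      have "emeasure ?N B = emeasure \<mu> (?\<psi> -` B \<inter> space \<mu>)"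
        by (rule emeasure_distr[OF \<psi> B'])
      also have "\<dots> = emeasure \<mu> B"
      proof (rule emeasure_eq_AE[OF _ measurable_sets[OF \<psi> B'] B])
        show "AE p in \<mu>. (p \<in> ?\<psi> -` B \<inter> space \<mu>) = (p \<in> B)"
          using C(5) AE_space by eventually_elim simp
      qed
      finally show "emeasure ?N B = emeasure \<mu> B" .
    qed
    have fin: "finite_measure ?N"
      by (rule finite_measure.finite_measure_distr[OF \<mu>(2) \<psi>])
    show "u \<in> INA \<nu> t"
      using conull_trace.norm_attaining_eq[OF ct, of ?\<phi> u] \<mu>(3-5) fin
      unfolding INA_def is_borel_measure_\<nu> by (intro CollectI exI[of _ ?N]) simp
  next
    fix u assume "u \<in> INA \<nu> t"
    then obtain N where N: "sets N = sets Borel\<^sub>\<nu>" "finite_measure N" "bochner_integrable_on N ?\<phi>"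
        "has_bochner_value N ?\<phi> u" "measure N (space N) = norm u"
      unfolding INA_def is_borel_measure_\<nu> by blast
    have sp: "space N = D"
      using sets_eq_imp_space_eq[OF N(1)] by simp
    obtain CX CY where C: "countable CX" "countable CY" "CX \<subseteq> S" "CY \<subseteq> T"
        "AE p in N. p \<in> separable_part CX CY"
      using AE_separable_part[OF sp _ N(2-5)] N(1) Borel\<^sub>\<tau>_subset_Borel\<^sub>\<nu> by blast
    let ?A = "separable_part CX CY"
    have A: "?A \<in> sets Borel\<^sub>\<tau>"
      by (rule separable_part_sets[OF C(1-4)])
    have A': "?A \<in> sets N"
      using A Borel\<^sub>\<tau>_subset_Borel\<^sub>\<nu> N(1) by auto
    have id: "(\<lambda>p. p) \<in> measurable N Borel\<^sub>\<tau>"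
      using Borel\<^sub>\<tau>_subset_Borel\<^sub>\<nu> N(1) sp by (intro measurableI) auto
    \<comment> \<open>The image measure under the identity is the restriction of \<open>N\<close> to
      the coarse Borel sets.\<close>
    let ?M = "distr N Borel\<^sub>\<tau> (\<lambda>p. p)"
    have emeasure_M: "emeasure ?M B = emeasure N B" if "B \<in> sets Borel\<^sub>\<tau>" for B
    proof -
      have "B \<subseteq> space N" using sets.sets_into_space[OF that] sp by simp
      then have "(\<lambda>p. p) -` B \<inter> space N = B" by auto
      then show ?thesis using emeasure_distr[OF id that] by simp
    qed
    have ct: "conull_trace ?M N ?A"
    proof
      show "space N = space ?M" by (simp add: sp)
      show "sets ?M \<subseteq> sets N" using Borel\<^sub>\<tau>_subset_Borel\<^sub>\<nu> N(1) by simp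
      show "?A \<in> sets ?M" using A by simp
      have "space ?M - ?A \<in> sets Borel\<^sub>\<tau>"
        using sets.compl_sets[OF A] by simp
      then have "emeasure ?M (space ?M - ?A) = emeasure N (space ?M - ?A)"
        by (rule emeasure_M)
      then show "emeasure ?M (space ?M - ?A) = 0"
        using emeasure_compl_eq_0[OF C(5) A'] by (simp add: sp)
      show "B \<inter> ?A \<in> sets ?M" if "B \<in> sets N" for B
        using that Borel\<^sub>\<nu>_trace[OF C(1-4)] N(1) by simp
      show "emeasure N B = emeasure ?M B" if "B \<in> sets ?M" for B
        using that emeasure_M by simp
    qed
    have fin: "finite_measure ?M"
      by (rule finite_measure.finite_measure_distr[OF N(2) id])
    show "u \<in> INA \<tau> t"
      using conull_trace.norm_attaining_eq[OF ct, of ?\<phi> u] N(3-5) fin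
      unfolding INA_def is_borel_measure_\<tau> by (intro CollectI exI[of _ ?M]) simp
  qed
  then show ?thesis
    by (simp add: INA_norm_def \<tau>_def \<nu>_def)
qed

end

section \<open>Norming families for a Banach space and for its dual\<close>

text \<open>The norming property is the Hahn-Banach theorem in the form of
  \<open>norming_functional\<close>.\<close>

lemma norming_subspace_UNIV:
  fixes s :: "'k::real_or_complex \<Rightarrow> 'a::real_normed_vector \<Rightarrow> 'a"
  assumes "normed_space_over s"
  shows "norming_subspace s UNIV {f \<in> bounded_functionals s UNIV. \<forall>x. norm (f x) \<le> norm x}"
proof -
  interpret normed_space_over s by fact
  show ?thesis
  proof
    fix x :: 'a and C :: real
    assume *: "\<And>f. f \<in> {f \<in> bounded_functionals s UNIV. \<forall>x. norm (f x) \<le> norm x} \<Longrightarrow> norm (f x) \<le> C"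
    obtain f where "f \<in> bounded_functionals s UNIV" "\<And>x. norm (f x) \<le> norm x" "norm x \<le> norm (f x)"
      using norming_functional[OF assms, of x] by metis
    then show "norm x \<le> C" using *[of f] by force
  qed auto
qed

section \<open>The dual space and its norming family\<close>

lemma dual_scale_apply: "blinfun_apply (dual_scale c f) x = c * blinfun_apply f x"
  by (simp add: dual_scale_def)

lemma norm_dual_scale: "norm (dual_scale c f) = norm c * norm f"
proof (rule antisym)
  have le: "norm (dual_scale c f) \<le> norm c * norm f" for c :: "'k::real_or_complex" and f :: "'a::real_normed_vector \<Rightarrow>\<^sub>L 'k"
  proof (rule norm_blinfun_bound)
    show "norm (dual_scale c f x) \<le> norm c * norm f * norm x" for x
      using norm_blinfun[of f x] by (simp add: dual_scale_apply norm_mult mult.assoc mult_left_mono)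
  qed simp
  show "norm (dual_scale c f) \<le> norm c * norm f" by (rule le)
  show "norm c * norm f \<le> norm (dual_scale c f)"
  proof (cases "c = 0")
    case False
    \<comment> \<open>The reverse inequality is \<open>le\<close> for the inverse scalar.\<close>
    have "f = dual_scale (inverse c) (dual_scale c f)"
      using False by (intro blinfun_eqI) (simp add: dual_scale_apply)
    then have "norm f \<le> norm (inverse c) * norm (dual_scale c f)"
      using le by metis
    then have "norm f \<le> norm (dual_scale c f) / norm c"
      by (simp add: norm_inverse divide_inverse mult.commute)
    then show ?thesis using False by (simp add: field_simps)
  qed simp
qed

lemma normed_space_over_dual: "normed_space_over dual_scale"
  by standard
    (auto intro!: blinfun_eqI simp: dual_scale_apply blinfun.add_left blinfun.scaleR_left norm_dual_scale
      scaleR_conv_of_real algebra_simps)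

lemma evaluation_functionals:
  "range (\<lambda>x f. blinfun_apply f x) \<subseteq> bounded_functionals dual_scale (dual_space s)"
proof -
  have "\<exists>C. \<forall>f\<in>dual_space s. norm (blinfun_apply f x) \<le> C * norm f" for x
    by (rule exI[of _ "norm x"]) (use norm_blinfun in \<open>auto simp: mult.commute\<close>)
  then show ?thesis
    by (auto simp: bounded_functionals_def blinfun.add_left dual_scale_apply)
qed

text \<open>The operator norm is the supremum of the evaluations on the unit ball of the
  predual.\<close>

lemma norming_subspace_dual:
  fixes s :: "'k::real_or_complex \<Rightarrow> 'a::real_normed_vector \<Rightarrow> 'a"
  shows "norming_subspace dual_scale (dual_space s) ((\<lambda>x f. blinfun_apply f x) ` {x. norm x \<le> 1})"
proof -
  interpret normed_space_over dual_scale by (rule normed_space_over_dual)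
  show ?thesis
  proof
    show "0 \<in> dual_space s"
      by (auto simp: dual_space_def bounded_functionals_def intro!: exI[of _ 0])
  next
    fix f g assume "f \<in> dual_space s" "g \<in> dual_space s"
    then show "f + g \<in> dual_space s"
      unfolding dual_space_def bounded_functionals_def
      using norm_blinfun[of "f + g"] by (auto simp: blinfun.add_left algebra_simps intro!: exI[of _ "norm (f + g)"])
  next
    fix f c assume "f \<in> dual_space s"
    then show "dual_scale c f \<in> dual_space s"
      unfolding dual_space_def bounded_functionals_def
      using norm_blinfun[of "dual_scale c f"]
      by (auto simp: dual_scale_apply algebra_simps intro!: exI[of _ "norm (dual_scale c f)"])
  next
    show "(\<lambda>x f. blinfun_apply f x) ` {x. norm x \<le> 1} \<subseteq> bounded_functionals dual_scale (dual_space s)"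
      using evaluation_functionals[of s] by blast
  next
    fix e :: "('a \<Rightarrow>\<^sub>L 'k) \<Rightarrow> 'k" and f :: "'a \<Rightarrow>\<^sub>L 'k"
    assume "e \<in> (\<lambda>x f. blinfun_apply f x) ` {x. norm x \<le> 1}"
    then obtain x where x: "e = (\<lambda>f. blinfun_apply f x)" "norm x \<le> 1" by blast
    have "norm (blinfun_apply f x) \<le> norm f * norm x" by (rule norm_blinfun)
    also have "\<dots> \<le> norm f * 1" using x(2) by (intro mult_left_mono) auto
    finally show "norm (e f) \<le> norm f" by (simp add: x(1))
  next
    fix f :: "'a \<Rightarrow>\<^sub>L 'k" and C :: real
    assume C: "C \<ge> 0" and *: "\<And>e. e \<in> (\<lambda>x f. blinfun_apply f x) ` {x. norm x \<le> 1} \<Longrightarrow> norm (e f) \<le> C"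
    show "norm f \<le> C"
    proof (rule norm_blinfun_bound[OF C])
      fix x
      have "norm (blinfun_apply f (x /\<^sub>R norm x)) \<le> C"
        by (rule *[of "\<lambda>f. blinfun_apply f (x /\<^sub>R norm x)"]) (rule imageI, cases "x = 0", auto)
      then show "norm (blinfun_apply f x) \<le> C * norm x"
        by (cases "x = 0") (auto simp: blinfun.scaleR_right field_simps)
    qed
  qed
qed

theorem theorem3:
  fixes sX :: "'k::real_or_complex \<Rightarrow> 'a::banach \<Rightarrow> 'a"
    and sY :: "'k \<Rightarrow> 'b::banach \<Rightarrow> 'b"
    and sZ :: "'k \<Rightarrow> 'z::banach \<Rightarrow> 'z"
    and sW :: "'k \<Rightarrow> 'w::banach \<Rightarrow> 'w"
    and tensor :: "'a \<Rightarrow> 'b \<Rightarrow> 'z"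
    and dual_tensor :: "('a \<Rightarrow>\<^sub>L 'k) \<Rightarrow> ('b \<Rightarrow>\<^sub>L 'k) \<Rightarrow> 'w"
  assumes "normed_space_over sX"
    and "normed_space_over sY"
  shows "(completed_projective_tensor_product sX UNIV sY UNIV sZ tensor \<longrightarrow>
            INA_weak sX UNIV sY UNIV tensor = INA_norm UNIV UNIV tensor) \<and>
         (completed_projective_tensor_product
              dual_scale (dual_space sX) dual_scale (dual_space sY) sW dual_tensor \<longrightarrow>
            INA_weak_star sX sY dual_tensor =
              INA_weak dual_scale (dual_space sX) dual_scale (dual_space sY) dual_tensor \<and>
            INA_weak dual_scale (dual_space sX) dual_scale (dual_space sY) dual_tensor =
              INA_norm (dual_space sX) (dual_space sY) dual_tensor)"
proof (intro conjI impI)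
  let ?F = "\<lambda>s. {f \<in> bounded_functionals s UNIV. \<forall>x. norm (f x) \<le> norm x}"
  let ?E = "(\<lambda>x f. blinfun_apply f x) ` {x. norm x \<le> 1}"
  have ne: "bounded_functionals s S \<noteq> {}" for s :: "'k \<Rightarrow> 'c::real_normed_vector \<Rightarrow> 'c" and S
  proof -
    have "(\<lambda>x. 0) \<in> bounded_functionals s S"
      by (auto simp: bounded_functionals_def intro!: exI[of _ 0])
    then show ?thesis by blast
  qed
  show "INA_weak sX UNIV sY UNIV tensor = INA_norm UNIV UNIV tensor"
    if "completed_projective_tensor_product sX UNIV sY UNIV sZ tensor"
  proof -
    interpret X: norming_subspace sX UNIV "?F sX" by (rule norming_subspace_UNIV[OF assms(1)])
    interpret Y: norming_subspace sY UNIV "?F sY" by (rule norming_subspace_UNIV[OF assms(2)])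
    interpret coarse_projective_tensor sX UNIV "?F sX" sY UNIV "?F sY" sZ tensor
      "weak_topology sX UNIV" "weak_topology sY UNIV"
      by standard (use that in \<open>auto simp: weak_topology_def intro!: X.coarse_initial_topology Y.coarse_initial_topology ne\<close>)
    show ?thesis
      unfolding INA_weak_def by (rule INA_coarse_eq_INA_norm)
  qed
  assume dual: "completed_projective_tensor_product
    dual_scale (dual_space sX) dual_scale (dual_space sY) sW dual_tensor"
  interpret X: norming_subspace dual_scale "dual_space sX" ?E by (rule norming_subspace_dual)
  interpret Y: norming_subspace dual_scale "dual_space sY" ?E by (rule norming_subspace_dual)
  show weak: "INA_weak dual_scale (dual_space sX) dual_scale (dual_space sY) dual_tensor =
      INA_norm (dual_space sX) (dual_space sY) dual_tensor"
  proof -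
    \<comment> \<open>Evaluations on the unit ball of the predual are bounded functionals on the
      dual, so the family \<open>?E\<close> serves for its weak topology as well.\<close>
    interpret coarse_projective_tensor dual_scale "dual_space sX" ?E dual_scale "dual_space sY" ?E sW dual_tensor
      "weak_topology dual_scale (dual_space sX)" "weak_topology dual_scale (dual_space sY)"
      unfolding weak_topology_def
      by (intro_locales; unfold_locales)
        (intro dual X.coarse_initial_topology Y.coarse_initial_topology X.F_functionals Y.F_functionals ne order_refl)+
    show ?thesis
      unfolding INA_weak_def by (rule INA_coarse_eq_INA_norm)
  qed
  have "INA_weak_star sX sY dual_tensor = INA_norm (dual_space sX) (dual_space sY) dual_tensor"
  proof -
    \<comment> \<open>The weak-star topology is generated by the evaluations at all vectors, which
      include \<open>?E\<close>.\<close>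
    interpret coarse_projective_tensor dual_scale "dual_space sX" ?E dual_scale "dual_space sY" ?E sW dual_tensor
      "weak_star_topology sX" "weak_star_topology sY"
      unfolding weak_star_topology_def
      by (intro_locales; unfold_locales)
        ((intro dual X.coarse_initial_topology Y.coarse_initial_topology evaluation_functionals image_mono subset_UNIV; simp)+)
    show ?thesis
      unfolding INA_weak_star_def by (rule INA_coarse_eq_INA_norm)
  qed
  with weak show "INA_weak_star sX sY dual_tensor =
      INA_weak dual_scale (dual_space sX) dual_scale (dual_space sY) dual_tensor"
    by simp
qed

end
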